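(* Let $T_p^{q,t}$ denote passage times of Brownian last passage percolation under the Ornstein--Uhlenbeck dynamics, and write $\mathbf{0}=(0,0)$, $\mathbf{n}=(n,n)$. There is an absolute constant $C$ such that, for every integer $n\ge1$, $t\ge0$ and $k\ge2$, $$\left\|T_{\mathbf{0}}^{\mathbf{n},t}-T_{\mathbf{0}}^{\mathbf{n},0}\right\|_k\le C\sqrt{kn(1-e^{-t})}\le C\sqrt{knt}.$$ In particular, for every $u\ge2$, $$\mathbb{P}\left(\left|T_{\mathbf{0}}^{\mathbf{n},t}-T_{\mathbf{0}}^{\mathbf{n},0}\right|>C\sqrt{n(1-e^{-t})u}\right)\le2e^{-u}.$$
   Context: $\|Y\|_k=(\mathbb{E}|Y|^k)^{1/k}$. Ornstein--Uhlenbeck (OU) dynamics: $(B_j^r)_{j\in\mathbb{Z},r\in\mathbb{R}}$ is the stationary OU Brownian environment: a (jointly Gaussian) stationary process in $r$ for which each $B_j^r$ is a two-sided standard Brownian motion with $B_j^r(0)=0$, the correlation of the same Brownian increment at times $r,r'$ is $e^{-|r-r'|}$, and different rows $j$ evolve independently. For $p=(x_0,j_0)\le q=(x_1,j_1)$ in $\mathbb{R}\times\mathbb{Z}$ (i.e. $x_0\le x_1$, $j_0\le j_1$), a staircase $\xi$ from $p$ to $q$ is given by $x_0=\xi(j_0-1)\le\xi(j_0)\le\cdots\le\xi(j_1)=x_1$; its weight at time $t$ is $\sum_{j=j_0}^{j_1}(B_j^t(\xi(j))-B_j^t(\xi(j-1)))$, and $T_p^{q,t}$ is the maximum of this weight over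 all staircases from $p$ to $q$. *)

theory Defs
  imports "HOL-Probability.Probability"
begin

definition Lp_norm :: "'a measure \<Rightarrow> real \<Rightarrow> ('a \<Rightarrow> real) \<Rightarrow> real" where
  "Lp_norm M k Y = (\<integral>\<omega>. \<bar>Y \<omega>\<bar> powr k \<partial>M) powr (1 / k)"

context prob_space
begin

definition covariance :: "('a \<Rightarrow> real) \<Rightarrow> ('a \<Rightarrow> real) \<Rightarrow> real" where
  "covariance X Y = expectation (\<lambda>\<omega>. (X \<omega> - expectation X) * (Y \<omega> - expectation Y))"

definition correlation :: "('a \<Rightarrow> real) \<Rightarrow> ('a \<Rightarrow> real) \<Rightarrow> real" where
  "correlation X Y = covariance X Y / (sqrt (variance X) * sqrt (variance Y))"

text \<open>Almost surely constant variables count as (degenerate) Gaussians.\<close>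

definition gaussian :: "('a \<Rightarrow> real) \<Rightarrow> bool" where
  "gaussian X \<longleftrightarrow> random_variable borel X \<and>
     ((\<exists>\<mu> \<sigma>. \<sigma> > 0 \<and> distributed M lborel X (normal_density \<mu> \<sigma>)) \<or>
      (\<exists>c. AE \<omega> in M. X \<omega> = c))"

definition jointly_gaussian :: "('i \<Rightarrow> 'a \<Rightarrow> real) \<Rightarrow> bool" where
  "jointly_gaussian X \<longleftrightarrow>
     (\<forall>F a. finite F \<longrightarrow> gaussian (\<lambda>\<omega>. \<Sum>i\<in>F. a i * X i \<omega>))"

text \<open>Standard Brownian motion indexed by the whole real line. Paths are continuous for every
  sample point, not just almost every one.\<close>

definition two_sided_brownian_motion :: "(real \<Rightarrow> 'a \<Rightarrow> real) \<Rightarrow> bool" where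
  "two_sided_brownian_motion W \<longleftrightarrow>
     (\<forall>x. random_variable borel (W x)) \<and>
     (\<forall>\<omega>\<in>space M. W 0 \<omega> = 0) \<and>
     (\<forall>\<omega>\<in>space M. continuous_on UNIV (\<lambda>x. W x \<omega>)) \<and>
     (\<forall>x y. x < y \<longrightarrow>
        distributed M lborel (\<lambda>\<omega>. W y \<omega> - W x \<omega>) (normal_density 0 (sqrt (y - x)))) \<and>
     (\<forall>x :: nat \<Rightarrow> real. \<forall>m. incseq x \<longrightarrow>
        indep_vars (\<lambda>_. borel) (\<lambda>i \<omega>. W (x (Suc i)) \<omega> - W (x i) \<omega>) {..<m})"

end

text \<open>\<open>B j r x \<omega>\<close> is the height at position \<open>x\<close> of the \<open>j\<close>-th Brownian motion at
  dynamical time \<open>r\<close>. The assumption on disjoint increments is needed because the correlations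
  of equal increments only determine the part of the cross-covariance between times \<open>r\<close> and
  \<open>r'\<close> that is symmetric under exchanging the two positions. All covariances are then
  those of the Ornstein--Uhlenbeck evolution.\<close>

locale ou_brownian_environment = prob_space M
  for M :: "'a measure" +
  fixes B :: "int \<Rightarrow> real \<Rightarrow> real \<Rightarrow> 'a \<Rightarrow> real"
  assumes brownian: "\<And>j r. two_sided_brownian_motion (B j r)"
    and gaussian_process: "jointly_gaussian (\<lambda>(j, r, x). B j r x)"
    and stationary: "\<And>s.
      distr M (\<Pi>\<^sub>M i\<in>(UNIV :: (int \<times> real \<times> real) set). borel)
        (\<lambda>\<omega> (j, r, x). B j (r + s) x \<omega>) =
      distr M (\<Pi>\<^sub>M i\<in>(UNIV :: (int \<times> real \<times> real) set). borel)
        (\<lambda>\<omega> (j, r, x). B j r x \<omega>)"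
    and same_increment: "\<And>j r r' x y. x < y \<Longrightarrow>
      correlation (\<lambda>\<omega>. B j r y \<omega> - B j r x \<omega>) (\<lambda>\<omega>. B j r' y \<omega> - B j r' x \<omega>)
        = exp (- \<bar>r - r'\<bar>)"
    and disjoint_increments: "\<And>j r r' x y x' y'. x < y \<Longrightarrow> y \<le> x' \<Longrightarrow> x' < y' \<Longrightarrow>
      correlation (\<lambda>\<omega>. B j r y \<omega> - B j r x \<omega>) (\<lambda>\<omega>. B j r' y' \<omega> - B j r' x' \<omega>) = 0"
    and independent_rows:
      "indep_vars (\<lambda>_ :: int. \<Pi>\<^sub>M i\<in>(UNIV :: (real \<times> real) set). borel)
        (\<lambda>j \<omega> (r, x). B j r x \<omega>) UNIV"

text \<open>Only the values of a staircase on \<open>{j0 - 1..j1}\<close> matter.\<close>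

definition staircases :: "real \<times> int \<Rightarrow> real \<times> int \<Rightarrow> (int \<Rightarrow> real) set" where
  "staircases p q = (case (p, q) of ((x0, j0), (x1, j1)) \<Rightarrow>
     {\<xi>. \<xi> (j0 - 1) = x0 \<and> \<xi> j1 = x1 \<and> (\<forall>j\<in>{j0..j1}. \<xi> (j - 1) \<le> \<xi> j)})"

definition staircase_weight ::
    "(int \<Rightarrow> real \<Rightarrow> real) \<Rightarrow> real \<times> int \<Rightarrow> real \<times> int \<Rightarrow> (int \<Rightarrow> real) \<Rightarrow> real" where
  "staircase_weight b p q \<xi> = (\<Sum>j\<in>{snd p..snd q}. b j (\<xi> j) - b j (\<xi> (j - 1)))"

text \<open>For continuous environments and \<open>p \<le> q\<close> (in both coordinates) the supremum is a
  maximum, since the staircases form a nonempty compact set.\<close>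

definition passage_time ::
    "(int \<Rightarrow> real \<Rightarrow> real \<Rightarrow> 'a \<Rightarrow> real) \<Rightarrow> real \<times> int \<Rightarrow> real \<times> int \<Rightarrow> real \<Rightarrow> 'a \<Rightarrow> real" where
  "passage_time B p q t \<omega> =
     (SUP \<xi>\<in>staircases p q. staircase_weight (\<lambda>j x. B j t x \<omega>) p q \<xi>)"

end

theory Submission
  imports Defs
begin

text \<open>Fix two dynamical times at distance \<open>t\<close> and write \<open>cos \<phi> = exp (- t)\<close>. Both environments lie on
a quarter circle of Gaussian environments: if \<open>V\<close> is the one at time \<open>0\<close> and \<open>W\<close> an independent copy of
it, chosen so that the one at time \<open>t\<close> is \<open>cos \<phi> V + sin \<phi> W\<close>, then every
\<open>Z \<theta> = cos \<theta> V + sin \<theta> W\<close> has the law of \<open>V\<close>, and its derivative \<open>Z' \<theta>\<close> is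
independent of \<open>Z \<theta>\<close> and again has the law of \<open>V\<close>. The speed of the passage time along this curve is the
\<open>Z' \<theta>\<close>-weight of the geodesic of \<open>Z \<theta>\<close>; given \<open>Z \<theta>\<close> this is a centered Gaussian of
variance \<open>n\<close>, since a staircase from \<open>(0, 0)\<close> to \<open>(n, n)\<close> collects increments of total length \<open>n\<close>.
Convexity of the exponential function turns this into
\<open>E exp (\<gamma> (T\<^sup>t - T\<^sup>0)) \<le> exp (\<gamma>\<^sup>2 \<phi>\<^sup>2 n / 2)\<close>,
and \<open>\<phi>\<^sup>2\<close> is at most a constant times \<open>1 - exp (- t)\<close>. Moments and tails follow from this exponential
bound (\<open>subgaussian_moments\<close>, \<open>subgaussian_tail\<close>). Running along the Ornstein--Uhlenbeck path itself would
not do: it is not differentiable in time, and its drift alone displaces the passage time by the order of \<open>n t\<close>.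

Two devices avoid derivatives and geodesics. The passage time is the limit of the maximum over finitely many rational
staircases (\<open>Max_rational_staircases_tendsto\<close>), so by Fatou's lemma a bound for maxima of finitely many jointly
Gaussian variables suffices (\<open>exp_Max_correlated\<close>). The curve is cut into \<open>N\<close> pieces; over one piece the
maximum decreases backwards at most as much as the coordinate that is maximal at its end (\<open>exp_Max_decrement\<close>), and
\<open>N\<close> tends to infinity (\<open>exp_Max_rotation\<close>).

The independence of \<open>Z \<theta>\<close> and \<open>Z' \<theta>\<close> has to be derived from joint Gaussianity, which is a statement
about one-dimensional linear combinations only. This is the role of the Cramer--Wold theorem
(\<open>Cramer_Wold\<close>, \<open>nn_integral_decouple\<close>).\<close>

section \<open>Laws of random vectors and characteristic functions\<close>

lemma (in prob_space) integrable_iexp_mult: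
  assumes [measurable]: "X \<in> borel_measurable M" "f \<in> borel_measurable M"
    and b: "\<And>\<omega>. \<bar>f \<omega>\<bar> \<le> c"
  shows "integrable M (\<lambda>\<omega>. complex_of_real (f \<omega>) * iexp (X \<omega>))"
  by (rule integrable_const_bound[where B = c]) (auto simp: norm_mult b)

text \<open>Levy's uniqueness theorem for laws tilted by a density. The lower bound \<open>1\<close> on the weights keeps their total mass
away from zero, so that both tilted laws can be normalised to probability measures.\<close>

lemma weighted_law_eqI:
  fixes X f :: "'a \<Rightarrow> real" and Y g :: "'b \<Rightarrow> real"
  assumes "prob_space M" "prob_space N"
    and m[measurable]: "X \<in> borel_measurable M" "f \<in> borel_measurable M"
      "Y \<in> borel_measurable N" "g \<in> borel_measurable N"
    and f: "\<And>\<omega>. 1 \<le> f \<omega> \<and> f \<omega> \<le> c" and g: "\<And>\<omega>. 1 \<le> g \<omega> \<and> g \<omega> \<le> c"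
    and eq: "\<And>s. (CLINT \<omega>|M. f \<omega> * iexp (s * X \<omega>)) = (CLINT \<omega>|N. g \<omega> * iexp (s * Y \<omega>))"
    and A[measurable]: "A \<in> sets borel"
  shows "(LINT \<omega>|M. f \<omega> * indicator A (X \<omega>)) = (LINT \<omega>|N. g \<omega> * indicator A (Y \<omega>))"
proof -
  interpret M: prob_space M by fact
  interpret N: prob_space N by fact
  have intf: "integrable M f" and intg: "integrable N g"
    using order_trans[OF zero_le_one conjunct1[OF f]] order_trans[OF zero_le_one conjunct1[OF g]] f g
    by (auto intro!: M.integrable_const_bound[where B = c] N.integrable_const_bound[where B = c])
  define m where "m = (LINT \<omega>|M. f \<omega>)"
  have m_g: "m = (LINT \<omega>|N. g \<omega>)"
    using eq[of 0] by (simp add: m_def)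
  have "(LINT \<omega>|M. 1) \<le> m"
    unfolding m_def using f intf by (intro integral_mono) auto
  then have m1: "m \<ge> 1" by (simp add: M.prob_space)
  have key: "prob_space (density K (\<lambda>\<omega>. h \<omega> / m)) \<and>
      char (distr (density K (\<lambda>\<omega>. h \<omega> / m)) borel Z) = (\<lambda>s. (CLINT \<omega>|K. h \<omega> * iexp (s * Z \<omega>)) / m) \<and>
      measure (distr (density K (\<lambda>\<omega>. h \<omega> / m)) borel Z) A = (LINT \<omega>|K. h \<omega> * indicator A (Z \<omega>)) / m"
    if "prob_space K" and [measurable]: "Z \<in> borel_measurable K" "h \<in> borel_measurable K"
      and h: "\<And>\<omega>. 1 \<le> h \<omega> \<and> h \<omega> \<le> c" and hm: "(LINT \<omega>|K. h \<omega>) = m" for K :: "'k measure" and Z h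
  proof -
    interpret K: prob_space K by fact
    have inth: "integrable K h"
      using order_trans[OF zero_le_one conjunct1[OF h]] h by (auto intro!: K.integrable_const_bound[where B = c])
    have pos: "0 \<le> h \<omega>" for \<omega> using h[of \<omega>] by linarith
    have "(\<integral>\<^sup>+\<omega>. ennreal (h \<omega> / m) \<partial>K) = ennreal (LINT \<omega>|K. h \<omega> / m)"
      using inth pos m1 by (intro nn_integral_eq_integral) auto
    then have 1: "prob_space (density K (\<lambda>\<omega>. h \<omega> / m))"
      using hm m1 by (intro prob_spaceI) (simp add: emeasure_density)
    have 2: "char (distr (density K (\<lambda>\<omega>. h \<omega> / m)) borel Z) s = (CLINT \<omega>|K. h \<omega> * iexp (s * Z \<omega>)) / m" for s
    proof -
      have "char (distr (density K (\<lambda>\<omega>. h \<omega> / m)) borel Z) s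
        = (CLINT \<omega>|K. (h \<omega> / m) *\<^sub>R iexp (s * Z \<omega>))"
        unfolding char_def using pos m1 by (subst integral_distr) (auto simp: integral_density)
      also have "\<dots> = (CLINT \<omega>|K. h \<omega> * iexp (s * Z \<omega>) / m)"
        by (rule Bochner_Integration.integral_cong) (auto simp: scaleR_conv_of_real)
      finally show ?thesis by simp
    qed
    interpret D: prob_space "density K (\<lambda>\<omega>. h \<omega> / m)" by (rule 1)
    have "measure (distr (density K (\<lambda>\<omega>. h \<omega> / m)) borel Z) A
        = measure (density K (\<lambda>\<omega>. h \<omega> / m)) (Z -` A \<inter> space K)"
      by (simp add: measure_distr)
    also have "\<dots> = (LINT \<omega>|density K (\<lambda>\<omega>. h \<omega> / m). indicator (Z -` A \<inter> space K) \<omega>)"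
      by simp
    also have "\<dots> = (LINT \<omega>|K. (h \<omega> / m) * indicator (Z -` A \<inter> space K) \<omega>)"
      using pos m1 by (subst integral_density) auto
    also have "\<dots> = (LINT \<omega>|K. h \<omega> * indicator A (Z \<omega>) / m)"
      by (rule Bochner_Integration.integral_cong) (auto simp: indicator_def)
    finally show ?thesis using 1 2 by auto
  qed
  note kM = key[OF assms(1) m(1,2) f m_def[symmetric]]
  note kN = key[OF assms(2) m(3,4) g m_g[symmetric]]
  have "distr (density M (\<lambda>\<omega>. f \<omega> / m)) borel X = distr (density N (\<lambda>\<omega>. g \<omega> / m)) borel Y"
  proof (rule Levy_uniqueness)
    show "real_distribution (distr (density M (\<lambda>\<omega>. f \<omega> / m)) borel X)"
      using kM by (intro prob_space.real_distribution_distr) auto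
    show "real_distribution (distr (density N (\<lambda>\<omega>. g \<omega> / m)) borel Y)"
      using kN by (intro prob_space.real_distribution_distr) auto
    show "char (distr (density M (\<lambda>\<omega>. f \<omega> / m)) borel X) = char (distr (density N (\<lambda>\<omega>. g \<omega> / m)) borel Y)"
      using kM kN eq by simp
  qed
  then show ?thesis using kM kN m1 by simp
qed

text \<open>A weight of the form \<open>2 + p cos\<close> multiplied by a character is a combination of characters; this keeps the
induction in \<open>rectangle_iexp_eq\<close> within the span of exponentials.\<close>

lemma cos_weight_times_iexp:
  "complex_of_real (2 + p * cos (x + \<theta>)) * iexp y
    = 2 * iexp y + (iexp \<theta> / 2) * (p * iexp (y + x)) + (iexp (- \<theta>) / 2) * (p * iexp (y - x))"
proof -
  have euler: "complex_of_real (cos (x + \<theta>)) = (iexp (\<theta> + x) + iexp (- \<theta> - x)) / 2"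
    by (simp only: cos_exp_eq cos_of_real[symmetric]) (simp add: algebra_simps)
  have e: "iexp (s + t) = iexp s * iexp t" "iexp (s - t) = iexp s * iexp (- t)" for s t
    by (simp_all only: exp_add[symmetric] distrib_left[symmetric] of_real_add[symmetric]) simp_all
  have ring: "(2 + p' * ((a * b + a' * b') / 2)) * c = 2 * c + (a / 2) * (p' * (c * b)) + (a' / 2) * (p' * (c * b'))"
    for p' a b a' b' c :: complex
    by (simp add: field_simps)
  show ?thesis
    unfolding e of_real_add[of 2] of_real_mult euler of_real_numeral by (rule ring)
qed

lemma integral_linear_combination3:
  fixes f g h :: "'a \<Rightarrow> complex"
  assumes "integrable M f" "integrable M g" "integrable M h"
  shows "(CLINT \<omega>|M. a * f \<omega> + b * g \<omega> + c * h \<omega>)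
    = a * integral\<^sup>L M f + b * integral\<^sup>L M g + c * integral\<^sup>L M h"
  using assms by simp

text \<open>Coordinates are upgraded one at a time from characters to indicators. Suppose that this has been done for those in
\<open>J\<close>, and let \<open>p\<close> be the product of their indicators. For fixed \<open>a\<close> and \<open>\<theta>\<close> the
nonnegative weight \<open>2 + p cos (\<Sum>a\<^sub>i X\<^sub>i + \<theta>)\<close> has, by the induction hypothesis, the same integrals against
the characters of the next coordinate \<open>X\<^sub>j\<close> on both spaces, so \<open>weighted_law_eqI\<close> allows replacing them
by the indicator of a Borel set. The phases \<open>\<theta> = 0\<close> and \<open>\<theta> = - \<pi>/2\<close> recover the real and the
imaginary part of the remaining character.\<close>

lemma rectangle_iexp_eq:
  fixes X :: "'i \<Rightarrow> 'a \<Rightarrow> real" and Y :: "'i \<Rightarrow> 'b \<Rightarrow> real"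
  assumes "prob_space M" "prob_space N" "finite I"
    and mX[measurable]: "\<And>i. i \<in> I \<Longrightarrow> X i \<in> borel_measurable M" and mY[measurable]: "\<And>i. i \<in> I \<Longrightarrow> Y i \<in> borel_measurable N"
    and eq: "\<And>a. (CLINT \<omega>|M. iexp (\<Sum>i\<in>I. a i * X i \<omega>)) = (CLINT \<omega>|N. iexp (\<Sum>i\<in>I. a i * Y i \<omega>))"
    and A: "\<And>i. i \<in> I \<Longrightarrow> A i \<in> sets borel"
    and "J \<subseteq> I"
  shows "(CLINT \<omega>|M. complex_of_real (\<Prod>i\<in>J. indicator (A i) (X i \<omega>)) * iexp (\<Sum>i\<in>I. a i * X i \<omega>))
    = (CLINT \<omega>|N. complex_of_real (\<Prod>i\<in>J. indicator (A i) (Y i \<omega>)) * iexp (\<Sum>i\<in>I. a i * Y i \<omega>))"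
  using finite_subset[OF \<open>J \<subseteq> I\<close> \<open>finite I\<close>] \<open>J \<subseteq> I\<close>
proof (induction J arbitrary: a rule: finite_induct)
  case empty
  then show ?case using eq by simp
next
  case (insert j J)
  interpret M: prob_space M by fact
  interpret N: prob_space N by fact
  have j: "j \<in> I" and J: "J \<subseteq> I" using insert by auto
  note [measurable] = mX[OF j] mY[OF j] A[OF j]
  define p where "p \<omega> = (\<Prod>i\<in>J. indicator (A i) (X i \<omega>) :: real)" for \<omega>
  define q where "q \<omega> = (\<Prod>i\<in>J. indicator (A i) (Y i \<omega>) :: real)" for \<omega>
  have pm[measurable]: "p \<in> borel_measurable M"
    unfolding p_def using J mX A by (intro borel_measurable_prod borel_measurable_indicator') (auto)
  have qm[measurable]: "q \<in> borel_measurable N"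
    unfolding q_def using J mY A by (intro borel_measurable_prod borel_measurable_indicator') (auto)
  have p01: "0 \<le> p \<omega>" "p \<omega> \<le> 1" for \<omega> unfolding p_def by (auto intro!: prod_nonneg prod_le_1 simp: indicator_def)
  have q01: "0 \<le> q \<omega>" "q \<omega> \<le> 1" for \<omega> unfolding q_def by (auto intro!: prod_nonneg prod_le_1 simp: indicator_def)
  define S where "S b \<omega> = (\<Sum>i\<in>I. b i * X i \<omega>)" for b \<omega>
  define T where "T b \<omega> = (\<Sum>i\<in>I. b i * Y i \<omega>)" for b \<omega>
  have Sm[measurable]: "S b \<in> borel_measurable M" for b unfolding S_def by measurable
  have Tm[measurable]: "T b \<in> borel_measurable N" for b unfolding T_def by measurable
  have IH: "(CLINT \<omega>|M. p \<omega> * iexp (S b \<omega>)) = (CLINT \<omega>|N. q \<omega> * iexp (T b \<omega>))" for b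
    using insert.IH[OF J, of b] unfolding p_def q_def S_def T_def .
  have base: "(CLINT \<omega>|M. iexp (S b \<omega>)) = (CLINT \<omega>|N. iexp (T b \<omega>))" for b
    using eq[of b] unfolding S_def T_def .
  \<comment> \<open>Adding \<open>e s\<close> to the coefficients multiplies the character by \<open>iexp (s * X j \<omega>)\<close>.\<close>
  define e where "e s i = (if i = j then s else 0 :: real)" for s i
  have Se: "S (e s) \<omega> = s * X j \<omega>" and Te: "T (e s) \<omega>' = s * Y j \<omega>'" for s \<omega> \<omega>'
    unfolding S_def T_def e_def using j \<open>finite I\<close> by (auto simp: if_distrib[of "\<lambda>x. x * _"] sum.delta cong: if_cong)
  have Sadd: "S (\<lambda>i. e s i + b i) \<omega> = s * X j \<omega> + S b \<omega>" "S (\<lambda>i. e s i - b i) \<omega> = s * X j \<omega> - S b \<omega>"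
     and Tadd: "T (\<lambda>i. e s i + b i) \<omega>' = s * Y j \<omega>' + T b \<omega>'" "T (\<lambda>i. e s i - b i) \<omega>' = s * Y j \<omega>' - T b \<omega>'" for s b \<omega> \<omega>'
    using Se[of s \<omega>] Te[of s \<omega>'] unfolding S_def T_def by (simp_all add: algebra_simps sum.distrib sum_subtractf)
  have law: "(LINT \<omega>|M. (2 + p \<omega> * cos (S a \<omega> + \<theta>)) * indicator (A j) (X j \<omega>))
    = (LINT \<omega>|N. (2 + q \<omega> * cos (T a \<omega> + \<theta>)) * indicator (A j) (Y j \<omega>))" for \<theta>
  proof (rule weighted_law_eqI[OF assms(1,2), where c = 3])
    have *: "\<bar>x * cos y\<bar> \<le> 1" if "0 \<le> x" "x \<le> 1" for x y :: real
      using that by (simp add: abs_mult mult_le_one)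
    show "1 \<le> 2 + p \<omega> * cos (S a \<omega> + \<theta>) \<and> 2 + p \<omega> * cos (S a \<omega> + \<theta>) \<le> 3" for \<omega>
      using *[OF p01, of \<omega> "S a \<omega> + \<theta>"] by linarith
    show "1 \<le> 2 + q \<omega> * cos (T a \<omega> + \<theta>) \<and> 2 + q \<omega> * cos (T a \<omega> + \<theta>) \<le> 3" for \<omega>
      using *[OF q01, of \<omega> "T a \<omega> + \<theta>"] by linarith
  next
    fix s
    have "(CLINT \<omega>|M. complex_of_real (2 + p \<omega> * cos (S a \<omega> + \<theta>)) * iexp (s * X j \<omega>))
      = (CLINT \<omega>|M. 2 * iexp (S (e s) \<omega>) + (iexp \<theta> / 2) * (p \<omega> * iexp (S (\<lambda>i. e s i + a i) \<omega>))
            + (iexp (- \<theta>) / 2) * (p \<omega> * iexp (S (\<lambda>i. e s i - a i) \<omega>)))"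
      by (simp only: cos_weight_times_iexp Se Sadd)
    also have "\<dots> = 2 * (CLINT \<omega>|M. iexp (S (e s) \<omega>)) + (iexp \<theta> / 2) * (CLINT \<omega>|M. p \<omega> * iexp (S (\<lambda>i. e s i + a i) \<omega>))
            + (iexp (- \<theta>) / 2) * (CLINT \<omega>|M. p \<omega> * iexp (S (\<lambda>i. e s i - a i) \<omega>))"
      using p01 by (intro integral_linear_combination3 M.integrable_iexp_mult[OF Sm pm, of 1] M.integrable_iexp) auto
    also have "\<dots> = 2 * (CLINT \<omega>|N. iexp (T (e s) \<omega>)) + (iexp \<theta> / 2) * (CLINT \<omega>|N. q \<omega> * iexp (T (\<lambda>i. e s i + a i) \<omega>))
            + (iexp (- \<theta>) / 2) * (CLINT \<omega>|N. q \<omega> * iexp (T (\<lambda>i. e s i - a i) \<omega>))"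
      unfolding IH base ..
    also have "\<dots> = (CLINT \<omega>|N. 2 * iexp (T (e s) \<omega>) + (iexp \<theta> / 2) * (q \<omega> * iexp (T (\<lambda>i. e s i + a i) \<omega>))
            + (iexp (- \<theta>) / 2) * (q \<omega> * iexp (T (\<lambda>i. e s i - a i) \<omega>)))"
      using q01 by (intro integral_linear_combination3[symmetric] N.integrable_iexp_mult[OF Tm qm, of 1] N.integrable_iexp) auto
    also have "\<dots> = (CLINT \<omega>|N. complex_of_real (2 + q \<omega> * cos (T a \<omega> + \<theta>)) * iexp (s * Y j \<omega>))"
      by (simp only: cos_weight_times_iexp Te Tadd)
    finally show "(CLINT \<omega>|M. complex_of_real (2 + p \<omega> * cos (S a \<omega> + \<theta>)) * iexp (s * X j \<omega>))
      = (CLINT \<omega>|N. complex_of_real (2 + q \<omega> * cos (T a \<omega> + \<theta>)) * iexp (s * Y j \<omega>))" .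
  qed measurable
  have plain: "(LINT \<omega>|M. (1::real) * indicator (A j) (X j \<omega>)) = (LINT \<omega>|N. (1::real) * indicator (A j) (Y j \<omega>))"
    by (rule weighted_law_eqI[OF assms(1,2), where c = 1 and f = "\<lambda>_. 1" and g = "\<lambda>_. 1"]) (use base[of "e _"] in \<open>auto simp: Se Te\<close>)
  define u where "u \<omega> = (indicator (A j) (X j \<omega>) :: real)" for \<omega>
  define v where "v \<omega> = (indicator (A j) (Y j \<omega>) :: real)" for \<omega>
  have um[measurable]: "u \<in> borel_measurable M" and vm[measurable]: "v \<in> borel_measurable N"
    unfolding u_def v_def by measurable
  have uv01: "0 \<le> u \<omega>" "u \<omega> \<le> 1" "0 \<le> v \<omega>'" "v \<omega>' \<le> 1" for \<omega> \<omega>'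
    by (simp_all add: u_def v_def indicator_def)
  have le1: "norm (x * cos y * z) \<le> 1" if "0 \<le> x" "x \<le> 1" "0 \<le> z" "z \<le> 1" for x y z :: real
    using that by (simp add: abs_mult mult_le_one)
  have "integrable M u" by (rule M.integrable_const_bound[where B = 1]) (simp_all add: uv01)
  moreover have "integrable M (\<lambda>\<omega>. p \<omega> * cos (S a \<omega> + \<theta>) * u \<omega>)" for \<theta>
    by (rule M.integrable_const_bound[where B = 1]) (use le1[OF p01 uv01(1,2)] in \<open>simp_all only: AE_I2\<close>, measurable)
  moreover have "integrable N v" by (rule N.integrable_const_bound[where B = 1]) (simp_all add: uv01)
  moreover have "integrable N (\<lambda>\<omega>. q \<omega> * cos (T a \<omega> + \<theta>) * v \<omega>)" for \<theta>
    by (rule N.integrable_const_bound[where B = 1]) (use le1[OF q01 uv01(3,4)] in \<open>simp_all only: AE_I2\<close>, measurable)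
  ultimately have cosin: "(LINT \<omega>|M. p \<omega> * cos (S a \<omega> + \<theta>) * u \<omega>) = (LINT \<omega>|N. q \<omega> * cos (T a \<omega> + \<theta>) * v \<omega>)" for \<theta>
    using law[of \<theta>] plain unfolding u_def[symmetric] v_def[symmetric] by (simp add: distrib_right)
  have re: "Re (complex_of_real x * iexp y) = x * cos y"
   and im: "Im (complex_of_real x * iexp y) = x * cos (y + - (pi/2))" for x y
    by (simp_all add: Re_exp Im_exp cos_diff)
  have iM: "integrable M (\<lambda>\<omega>. complex_of_real (u \<omega> * p \<omega>) * iexp (S a \<omega>))"
    using p01 by (intro M.integrable_iexp_mult[where c = 1]) (auto simp: uv01 abs_mult mult_le_one)
  have iN: "integrable N (\<lambda>\<omega>. complex_of_real (v \<omega> * q \<omega>) * iexp (T a \<omega>))"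
    using q01 by (intro N.integrable_iexp_mult[where c = 1]) (auto simp: uv01 abs_mult mult_le_one)
  have "(CLINT \<omega>|M. complex_of_real (u \<omega> * p \<omega>) * iexp (S a \<omega>))
      = (CLINT \<omega>|N. complex_of_real (v \<omega> * q \<omega>) * iexp (T a \<omega>))"
  proof (rule complex_eqI)
    show "Re (CLINT \<omega>|M. complex_of_real (u \<omega> * p \<omega>) * iexp (S a \<omega>))
      = Re (CLINT \<omega>|N. complex_of_real (v \<omega> * q \<omega>) * iexp (T a \<omega>))"
      using cosin[of 0, unfolded add_0_right] unfolding integral_Re[OF iM, symmetric] integral_Re[OF iN, symmetric] re
      by (simp only: mult_ac)
    show "Im (CLINT \<omega>|M. complex_of_real (u \<omega> * p \<omega>) * iexp (S a \<omega>))
      = Im (CLINT \<omega>|N. complex_of_real (v \<omega> * q \<omega>) * iexp (T a \<omega>))"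
      using cosin[of "- (pi/2)"] unfolding integral_Im[OF iM, symmetric] integral_Im[OF iN, symmetric] im
      by (simp only: mult_ac)
  qed
  then show ?case using insert.hyps by (simp add: p_def q_def u_def v_def S_def T_def)
qed

text \<open>With all coordinates upgraded and the remaining character trivial, the two laws agree on measurable rectangles.\<close>

theorem Cramer_Wold:
  fixes X :: "'i \<Rightarrow> 'a \<Rightarrow> real" and Y :: "'i \<Rightarrow> 'b \<Rightarrow> real"
  assumes "prob_space M" "prob_space N" "finite I"
    and mX[measurable]: "\<And>i. i \<in> I \<Longrightarrow> X i \<in> borel_measurable M" and mY[measurable]: "\<And>i. i \<in> I \<Longrightarrow> Y i \<in> borel_measurable N"
    and eq: "\<And>a. (CLINT \<omega>|M. iexp (\<Sum>i\<in>I. a i * X i \<omega>)) = (CLINT \<omega>|N. iexp (\<Sum>i\<in>I. a i * Y i \<omega>))"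
  shows "distr M (Pi\<^sub>M I (\<lambda>_. borel)) (\<lambda>\<omega>. \<lambda>i\<in>I. X i \<omega>) = distr N (Pi\<^sub>M I (\<lambda>_. borel)) (\<lambda>\<omega>. \<lambda>i\<in>I. Y i \<omega>)"
proof -
  interpret M: prob_space M by fact
  interpret N: prob_space N by fact
  have rect: "emeasure (distr K (Pi\<^sub>M I (\<lambda>_. borel)) (\<lambda>\<omega>. \<lambda>i\<in>I. Z i \<omega>)) (Pi\<^sub>E I A)
      = ennreal (Re (CLINT \<omega>|K. complex_of_real (\<Prod>i\<in>I. indicator (A i) (Z i \<omega>)) * iexp (\<Sum>i\<in>I. 0 * Z i \<omega>)))"
    if "prob_space K" and mZ[measurable]: "\<And>i. i \<in> I \<Longrightarrow> Z i \<in> borel_measurable K" and A: "\<And>i. i \<in> I \<Longrightarrow> A i \<in> sets borel"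
    for K :: "'k measure" and Z :: "'i \<Rightarrow> 'k \<Rightarrow> real" and A :: "'i \<Rightarrow> real set"
  proof -
    interpret K: prob_space K by fact
    have [measurable]: "(\<lambda>\<omega>. \<lambda>i\<in>I. Z i \<omega>) \<in> measurable K (Pi\<^sub>M I (\<lambda>_. borel))"
      by (rule measurable_restrict) (rule mZ)
    have "emeasure (distr K (Pi\<^sub>M I (\<lambda>_. borel)) (\<lambda>\<omega>. \<lambda>i\<in>I. Z i \<omega>)) (Pi\<^sub>E I A)
      = emeasure K ((\<lambda>\<omega>. \<lambda>i\<in>I. Z i \<omega>) -` Pi\<^sub>E I A \<inter> space K)"
      using A \<open>finite I\<close> by (intro emeasure_distr) (auto intro!: sets_PiM_I_finite)
    also have "\<dots> = ennreal (LINT \<omega>|K. indicator ((\<lambda>\<omega>. \<lambda>i\<in>I. Z i \<omega>) -` Pi\<^sub>E I A \<inter> space K) \<omega>)"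
      by (simp add: K.emeasure_eq_measure)
    also have "(LINT \<omega>|K. indicator ((\<lambda>\<omega>. \<lambda>i\<in>I. Z i \<omega>) -` Pi\<^sub>E I A \<inter> space K) \<omega>)
       = (LINT \<omega>|K. (\<Prod>i\<in>I. indicator (A i) (Z i \<omega>)) :: real)"
    proof (rule Bochner_Integration.integral_cong[OF refl])
      fix \<omega> assume "\<omega> \<in> space K"
      then show "indicator ((\<lambda>\<omega>. \<lambda>i\<in>I. Z i \<omega>) -` Pi\<^sub>E I A \<inter> space K) \<omega> = (\<Prod>i\<in>I. indicator (A i) (Z i \<omega>) :: real)"
        using \<open>finite I\<close> by (auto simp: indicator_def PiE_iff intro!: prod.neutral[symmetric] split: if_splits)
    qed
    also have "(LINT \<omega>|K. (\<Prod>i\<in>I. indicator (A i) (Z i \<omega>)))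
      = Re (CLINT \<omega>|K. complex_of_real (\<Prod>i\<in>I. indicator (A i) (Z i \<omega>)) * iexp (\<Sum>i\<in>I. 0 * Z i \<omega>))"
      by (simp flip: of_real_prod del: of_real_prod)
    finally show ?thesis .
  qed
  show ?thesis
  proof (rule measure_eqI_PiM_finite[OF \<open>finite I\<close>, where A = "\<lambda>_. space (Pi\<^sub>M I (\<lambda>_. borel))"])
    show "emeasure (distr M (Pi\<^sub>M I (\<lambda>_. borel)) (\<lambda>\<omega>. \<lambda>i\<in>I. X i \<omega>)) (Pi\<^sub>E I A)
       = emeasure (distr N (Pi\<^sub>M I (\<lambda>_. borel)) (\<lambda>\<omega>. \<lambda>i\<in>I. Y i \<omega>)) (Pi\<^sub>E I A)"
      if A: "\<And>i. i \<in> I \<Longrightarrow> A i \<in> sets borel" for A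
      using rectangle_iexp_eq[OF assms(1-6) A order_refl, where a = "\<lambda>_. 0"]
      by (simp add: rect[OF assms(1) mX A] rect[OF assms(2) mY A])
    have [measurable]: "(\<lambda>\<omega>. \<lambda>i\<in>I. X i \<omega>) \<in> measurable M (Pi\<^sub>M I (\<lambda>_. borel))"
      by (rule measurable_restrict) (rule mX)
    show "emeasure (distr M (Pi\<^sub>M I (\<lambda>_. borel)) (\<lambda>\<omega>. \<lambda>i\<in>I. X i \<omega>)) (space (Pi\<^sub>M I (\<lambda>_. borel))) \<noteq> \<infinity>"
      by (subst emeasure_distr) (auto)
    show "range (\<lambda>_::nat. space (Pi\<^sub>M I (\<lambda>_. borel))) \<subseteq> prod_algebra I (\<lambda>_. borel :: real measure)"
      using \<open>finite I\<close> by (auto simp: space_PiM intro!: prod_algebraI_finite)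
  qed auto
qed

section \<open>Gaussian linear spaces\<close>

text \<open>A linear space of centered Gaussian variables (a Gaussian Hilbert space without the completeness). Closure under linear
combinations makes joint Gaussianity available without any bookkeeping of coefficients.\<close>

locale gaussian_linear_space = prob_space M for M :: "'a measure" +
  fixes L :: "('a \<Rightarrow> real) set"
  assumes zero: "(\<lambda>_. 0) \<in> L"
    and add: "X \<in> L \<Longrightarrow> Y \<in> L \<Longrightarrow> (\<lambda>\<omega>. X \<omega> + Y \<omega>) \<in> L"
    and scale: "X \<in> L \<Longrightarrow> (\<lambda>\<omega>. c * X \<omega>) \<in> L"
    and gaussian: "X \<in> L \<Longrightarrow> gaussian X"
    and centered: "X \<in> L \<Longrightarrow> expectation X = 0"
begin

lemma linear_combination: "X \<in> L \<Longrightarrow> Y \<in> L \<Longrightarrow> (\<lambda>\<omega>. a * X \<omega> + b * Y \<omega>) \<in> L"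
  by (intro add scale)

lemma finite_linear_combination:
  "finite S \<Longrightarrow> (\<And>s. s \<in> S \<Longrightarrow> X s \<in> L) \<Longrightarrow> (\<lambda>\<omega>. \<Sum>s\<in>S. a s * X s \<omega>) \<in> L"
  by (induction S rule: finite_induct) (auto intro!: zero add scale)

lemma measurable: "X \<in> L \<Longrightarrow> X \<in> borel_measurable M"
  using gaussian unfolding gaussian_def by blast

lemma normal_or_null:
  assumes "X \<in> L"
  shows "(\<exists>\<sigma>>0. distributed M lborel X (normal_density 0 \<sigma>)) \<or> (AE \<omega> in M. X \<omega> = 0)"
  using gaussian[OF assms] unfolding gaussian_def
proof (elim conjE disjE exE)
  fix \<mu> \<sigma> assume \<sigma>: "\<sigma> > 0" and d: "distributed M lborel X (normal_density \<mu> \<sigma>)"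
  then have "\<mu> = 0"
    using normal_distributed_expectation[OF \<sigma> d] centered[OF assms] by simp
  then show ?thesis using \<sigma> d by blast
next
  fix c assume c: "AE \<omega> in M. X \<omega> = c"
  then have "expectation X = expectation (\<lambda>_. c)"
    using measurable[OF assms] by (intro integral_cong_AE) auto
  then show ?thesis using c centered[OF assms] by (simp add: prob_space)
qed

lemma square_integrable:
  assumes "X \<in> L"
  shows "integrable M (\<lambda>\<omega>. (X \<omega>)\<^sup>2)"
  using normal_or_null[OF assms]
proof (elim disjE exE conjE)
  fix \<sigma> assume \<sigma>: "\<sigma> > 0" and d: "distributed M lborel X (normal_density 0 \<sigma>)"
  have "integrable lborel (\<lambda>x. normal_density 0 \<sigma> x * x\<^sup>2)"
    using integrable_normal_moment[OF \<sigma>, of 0 2] by simp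
  then show ?thesis
    using distributed_integrable[OF d, of "\<lambda>x. x\<^sup>2"] by simp
next
  assume "AE \<omega> in M. X \<omega> = 0"
  then show ?thesis
    using measurable[OF assms] by (subst integrable_cong_AE[where g = "\<lambda>_. 0"]) auto
qed

lemma mult_integrable:
  assumes "X \<in> L" "Y \<in> L"
  shows "integrable M (\<lambda>\<omega>. X \<omega> * Y \<omega>)"
proof (rule Bochner_Integration.integrable_bound)
  show "integrable M (\<lambda>\<omega>. (X \<omega>)\<^sup>2 + (Y \<omega>)\<^sup>2)"
    using assms by (intro Bochner_Integration.integrable_add square_integrable)
  show "(\<lambda>\<omega>. X \<omega> * Y \<omega>) \<in> borel_measurable M"
    using assms measurable by simp
  have "\<bar>x * y\<bar> \<le> \<bar>x\<^sup>2 + y\<^sup>2\<bar>" for x y :: real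
    using sum_squares_bound[of "\<bar>x\<bar>" "\<bar>y\<bar>"] mult_nonneg_nonneg[OF abs_ge_zero[of x] abs_ge_zero[of y]]
    unfolding abs_mult power2_abs by linarith
  then show "AE \<omega> in M. norm (X \<omega> * Y \<omega>) \<le> norm ((X \<omega>)\<^sup>2 + (Y \<omega>)\<^sup>2)" by simp
qed

lemma expectation_mult_linear:
  assumes "X \<in> L" "Y \<in> L" "X' \<in> L" "Y' \<in> L"
  shows "expectation (\<lambda>\<omega>. (a * X \<omega> + b * Y \<omega>) * (c * X' \<omega> + d * Y' \<omega>))
    = a * c * expectation (\<lambda>\<omega>. X \<omega> * X' \<omega>) + a * d * expectation (\<lambda>\<omega>. X \<omega> * Y' \<omega>)
    + b * c * expectation (\<lambda>\<omega>. Y \<omega> * X' \<omega>) + b * d * expectation (\<lambda>\<omega>. Y \<omega> * Y' \<omega>)"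
proof -
  have "expectation (\<lambda>\<omega>. (a * X \<omega> + b * Y \<omega>) * (c * X' \<omega> + d * Y' \<omega>))
    = expectation (\<lambda>\<omega>. a * c * (X \<omega> * X' \<omega>) + a * d * (X \<omega> * Y' \<omega>)
      + b * c * (Y \<omega> * X' \<omega>) + b * d * (Y \<omega> * Y' \<omega>))"
    by (simp add: algebra_simps)
  then show ?thesis using assms by (simp add: mult_integrable)
qed

lemma second_moment_zero:
  assumes "AE \<omega> in M. X \<omega> = 0" "X \<in> L"
  shows "expectation (\<lambda>\<omega>. (X \<omega>)\<^sup>2) = 0"
proof -
  have "expectation (\<lambda>\<omega>. (X \<omega>)\<^sup>2) = expectation (\<lambda>\<omega>. 0)"
    using assms measurable by (intro integral_cong_AE) auto
  then show ?thesis by simp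
qed

lemma second_moment_normal:
  assumes "\<sigma> > 0" "distributed M lborel X (normal_density 0 \<sigma>)" "X \<in> L"
  shows "expectation (\<lambda>\<omega>. (X \<omega>)\<^sup>2) = \<sigma>\<^sup>2"
  using normal_distributed_variance[OF assms(1,2)] centered[OF assms(3)] by simp

lemma nn_integral_exp:
  assumes "X \<in> L"
  shows "(\<integral>\<^sup>+\<omega>. ennreal (exp (X \<omega>)) \<partial>M) = ennreal (exp (expectation (\<lambda>\<omega>. (X \<omega>)\<^sup>2) / 2))"
  using normal_or_null[OF assms]
proof (elim disjE exE conjE)
  fix \<sigma> assume \<sigma>: "\<sigma> > 0" and d: "distributed M lborel X (normal_density 0 \<sigma>)"
  have "(\<integral>\<^sup>+\<omega>. ennreal (exp (X \<omega>)) \<partial>M) = (\<integral>\<^sup>+x. ennreal (normal_density 0 \<sigma> x) * ennreal (exp x) \<partial>lborel)"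
    by (rule distributed_nn_integral[OF d, symmetric]) simp
  also have "\<dots> = (\<integral>\<^sup>+x. ennreal (exp (\<sigma>\<^sup>2 / 2)) * ennreal (normal_density (\<sigma>\<^sup>2) \<sigma> x) \<partial>lborel)"
  proof (rule nn_integral_cong)
    fix x
    have "- (x - 0)\<^sup>2 / (2 * \<sigma>\<^sup>2) + x = \<sigma>\<^sup>2 / 2 + - (x - \<sigma>\<^sup>2)\<^sup>2 / (2 * \<sigma>\<^sup>2)"
      using \<sigma> by (simp add: field_simps power2_eq_square)
    then have "exp (- (x - 0)\<^sup>2 / (2 * \<sigma>\<^sup>2)) * exp x = exp (\<sigma>\<^sup>2 / 2) * exp (- (x - \<sigma>\<^sup>2)\<^sup>2 / (2 * \<sigma>\<^sup>2))"
      by (simp only: exp_add[symmetric])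
    then have "normal_density 0 \<sigma> x * exp x = exp (\<sigma>\<^sup>2 / 2) * normal_density (\<sigma>\<^sup>2) \<sigma> x"
      unfolding normal_density_def by (simp add: mult_ac)
    then show "ennreal (normal_density 0 \<sigma> x) * ennreal (exp x) = ennreal (exp (\<sigma>\<^sup>2 / 2)) * ennreal (normal_density (\<sigma>\<^sup>2) \<sigma> x)"
      by (simp add: ennreal_mult[symmetric])
  qed
  also have "\<dots> = ennreal (exp (\<sigma>\<^sup>2 / 2)) * (\<integral>\<^sup>+x. ennreal (normal_density (\<sigma>\<^sup>2) \<sigma> x) \<partial>lborel)"
    by (rule nn_integral_cmult) simp
  also have "(\<integral>\<^sup>+x. ennreal (normal_density (\<sigma>\<^sup>2) \<sigma> x) \<partial>lborel) = 1"
    using \<sigma> by (subst nn_integral_eq_integral) auto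
  finally show ?thesis using second_moment_normal[OF \<sigma> d assms] by simp
next
  assume ae: "AE \<omega> in M. X \<omega> = 0"
  then have "(\<integral>\<^sup>+\<omega>. ennreal (exp (X \<omega>)) \<partial>M) = (\<integral>\<^sup>+\<omega>. 1 \<partial>M)"
    by (intro nn_integral_cong_AE) auto
  then show ?thesis using second_moment_zero[OF ae assms] by (simp add: emeasure_space_1)
qed

lemma expectation_iexp:
  assumes "X \<in> L"
  shows "(CLINT \<omega>|M. iexp (X \<omega>)) = exp (- expectation (\<lambda>\<omega>. (X \<omega>)\<^sup>2) / 2)"
  using normal_or_null[OF assms]
proof (elim disjE exE conjE)
  fix \<sigma> assume \<sigma>: "\<sigma> > 0" and d: "distributed M lborel X (normal_density 0 \<sigma>)"
  note [measurable] = measurable[OF assms]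
  have "distributed M lborel (\<lambda>\<omega>. (X \<omega> - 0) / \<sigma>) std_normal_density"
    using normal_standard_normal_convert[OF \<sigma>] d by blast
  then have "distr M lborel (\<lambda>\<omega>. X \<omega> / \<sigma>) = std_normal_distribution"
    by (simp add: distributed_distr_eq_density)
  then have law: "distr M borel (\<lambda>\<omega>. X \<omega> / \<sigma>) = std_normal_distribution"
    by (metis distr_cong sets_lborel)
  have "(CLINT \<omega>|M. iexp (X \<omega>)) = char (distr M borel (\<lambda>\<omega>. X \<omega> / \<sigma>)) \<sigma>"
    unfolding char_def using \<sigma> by (subst integral_distr) auto
  also have "\<dots> = exp (- (\<sigma>\<^sup>2) / 2)"
    unfolding law by (simp add: char_std_normal_distribution)
  finally show ?thesis using second_moment_normal[OF \<sigma> d assms] by (simp add: exp_of_real[symmetric])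
next
  assume ae: "AE \<omega> in M. X \<omega> = 0"
  note [measurable] = measurable[OF assms]
  have "(CLINT \<omega>|M. iexp (X \<omega>)) = (CLINT \<omega>|M. 1)"
    using ae by (intro integral_cong_AE) auto
  then show ?thesis using second_moment_zero[OF ae assms] by (simp add: prob_space)
qed

text \<open>Orthogonal families in a Gaussian space are independent: integrating a function of both families is the same as
integrating with the second family evaluated at an independent sample point. For a combination \<open>P\<close> of the first and
\<open>Q\<close> of the second family the variances of \<open>P\<close> and \<open>Q\<close> add up, so the characteristic function of
\<open>P + Q\<close> factors, and \<open>Cramer_Wold\<close> applies. The families are joined into one with index set
\<open>S \<times> UNIV\<close>, the Boolean telling which of them is meant.\<close>

lemma nn_integral_decouple:
  fixes X Y :: "'s \<Rightarrow> 'a \<Rightarrow> real"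
  assumes "finite S"
    and X: "\<And>s. s \<in> S \<Longrightarrow> X s \<in> L" and Y: "\<And>s. s \<in> S \<Longrightarrow> Y s \<in> L"
    and orth: "\<And>s s'. s \<in> S \<Longrightarrow> s' \<in> S \<Longrightarrow> expectation (\<lambda>\<omega>. X s \<omega> * Y s' \<omega>) = 0"
    and h[measurable]: "h \<in> borel_measurable (Pi\<^sub>M (S \<times> UNIV) (\<lambda>_. borel))"
  shows "(\<integral>\<^sup>+\<omega>. h (\<lambda>(s, b)\<in>S \<times> UNIV. if b then X s \<omega> else Y s \<omega>) \<partial>M)
    = (\<integral>\<^sup>+\<omega>. \<integral>\<^sup>+\<omega>'. h (\<lambda>(s, b)\<in>S \<times> UNIV. if b then X s \<omega> else Y s \<omega>') \<partial>M \<partial>M)"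
proof -
  interpret P: pair_prob_space M M ..
  define U where "U = (\<lambda>(s, b) \<omega>. if b then X s \<omega> else Y s \<omega>)"
  define V where "V = (\<lambda>(s, b) (\<omega>, \<omega>'). if b then X s \<omega> else Y s \<omega>')"
  have Xm[measurable]: "X s \<in> borel_measurable M" and Ym[measurable]: "Y s \<in> borel_measurable M" if "s \<in> S" for s
    using that X Y measurable by auto
  have Um[measurable]: "U i \<in> borel_measurable M" if "i \<in> S \<times> UNIV" for i
    using that Xm Ym unfolding U_def by (cases i) (auto simp: split_beta)
  have Vm[measurable]: "V i \<in> borel_measurable (M \<Otimes>\<^sub>M M)" if "i \<in> S \<times> UNIV" for i
    using that unfolding V_def by (cases i; cases "snd i") (auto simp: split_beta)
  have law: "distr M (Pi\<^sub>M (S \<times> UNIV) (\<lambda>_. borel)) (\<lambda>\<omega>. \<lambda>i\<in>S \<times> UNIV. U i \<omega>)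
    = distr (M \<Otimes>\<^sub>M M) (Pi\<^sub>M (S \<times> UNIV) (\<lambda>_. borel)) (\<lambda>\<omega>. \<lambda>i\<in>S \<times> UNIV. V i \<omega>)"
  proof (rule Cramer_Wold[OF prob_space_axioms P.prob_space_axioms])
    fix a :: "'s \<times> bool \<Rightarrow> real"
    define P where "P \<omega> = (\<Sum>s\<in>S. a (s, True) * X s \<omega>)" for \<omega>
    define Q where "Q \<omega> = (\<Sum>s\<in>S. a (s, False) * Y s \<omega>)" for \<omega>
    have PQ: "P \<in> L" "Q \<in> L"
      using finite_linear_combination[OF \<open>finite S\<close> X] finite_linear_combination[OF \<open>finite S\<close> Y]
      by (auto simp: P_def[abs_def] Q_def[abs_def])
    note [measurable] = PQ[THEN measurable]
    have "expectation (\<lambda>\<omega>. P \<omega> * Q \<omega>)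
       = expectation (\<lambda>\<omega>. \<Sum>s\<in>S. \<Sum>s'\<in>S. a (s, True) * a (s', False) * (X s \<omega> * Y s' \<omega>))"
      by (simp add: P_def Q_def sum_product mult_ac)
    also have "\<dots> = 0"
      using X Y orth by (simp add: Bochner_Integration.integral_sum mult_integrable)
    finally have "expectation (\<lambda>\<omega>. (1 * P \<omega> + 1 * Q \<omega>) * (1 * P \<omega> + 1 * Q \<omega>))
        = expectation (\<lambda>\<omega>. (P \<omega>)\<^sup>2) + expectation (\<lambda>\<omega>. (Q \<omega>)\<^sup>2)"
      by (subst expectation_mult_linear) (auto simp: PQ power2_eq_square mult.commute[of "Q _" "P _"])
    then have var: "expectation (\<lambda>\<omega>. (P \<omega> + Q \<omega>)\<^sup>2) = expectation (\<lambda>\<omega>. (P \<omega>)\<^sup>2) + expectation (\<lambda>\<omega>. (Q \<omega>)\<^sup>2)"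
      by (simp add: power2_eq_square)
    have split: "(\<Sum>i\<in>S \<times> UNIV. f i) = (\<Sum>s\<in>S. f (s, True)) + (\<Sum>s\<in>S. f (s, False))" for f :: "'s \<times> bool \<Rightarrow> real"
    proof -
      have "(\<Sum>i\<in>S \<times> UNIV. f i) = (\<Sum>s\<in>S. \<Sum>b\<in>UNIV. f (s, b))"
        by (simp add: sum.cartesian_product)
      then show ?thesis by (simp add: UNIV_bool sum.distrib add.commute)
    qed
    have "(CLINT \<omega>|M. iexp (\<Sum>i\<in>S \<times> UNIV. a i * U i \<omega>)) = (CLINT \<omega>|M. iexp (P \<omega> + Q \<omega>))"
      by (simp add: split U_def P_def Q_def)
    also have "\<dots> = exp (- expectation (\<lambda>\<omega>. (P \<omega> + Q \<omega>)\<^sup>2) / 2)"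
      using expectation_iexp[OF add[OF PQ]] .
    also have "\<dots> = (CLINT \<omega>|M. iexp (P \<omega>)) * (CLINT \<omega>|M. iexp (Q \<omega>))"
      by (simp add: expectation_iexp[OF PQ(1)] expectation_iexp[OF PQ(2)] var of_real_mult[symmetric] exp_add[symmetric]
          del: of_real_mult)
    also have "\<dots> = (CLINT \<omega>|M. (CLINT \<omega>'|M. iexp (P \<omega>) * iexp (Q \<omega>')))"
      by simp
    also have "\<dots> = (CLINT \<omega>|M. (CLINT \<omega>'|M. iexp (P (fst (\<omega>, \<omega>')) + Q (snd (\<omega>, \<omega>')))))"
      by (simp add: exp_add distrib_left)
    also have "\<dots> = (CLINT \<omega>|M \<Otimes>\<^sub>M M. iexp (P (fst \<omega>) + Q (snd \<omega>)))"
      by (rule P.integral_fst') (intro P.integrable_iexp, measurable)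
    also have "\<dots> = (CLINT \<omega>|M \<Otimes>\<^sub>M M. iexp (\<Sum>i\<in>S \<times> UNIV. a i * V i \<omega>))"
      by (simp add: split V_def P_def Q_def split_beta)
    finally show "(CLINT \<omega>|M. iexp (\<Sum>i\<in>S \<times> UNIV. a i * U i \<omega>)) = (CLINT \<omega>|M \<Otimes>\<^sub>M M. iexp (\<Sum>i\<in>S \<times> UNIV. a i * V i \<omega>))" .
  qed (use \<open>finite S\<close> in auto)
  have Urm[measurable]: "(\<lambda>\<omega>. \<lambda>i\<in>S \<times> UNIV. U i \<omega>) \<in> measurable M (Pi\<^sub>M (S \<times> UNIV) (\<lambda>_. borel))"
    by (rule measurable_restrict) (rule Um)
  have Vrm[measurable]: "(\<lambda>\<omega>. \<lambda>i\<in>S \<times> UNIV. V i \<omega>) \<in> measurable (M \<Otimes>\<^sub>M M) (Pi\<^sub>M (S \<times> UNIV) (\<lambda>_. borel))"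
    by (rule measurable_restrict) (rule Vm)
  have "(\<integral>\<^sup>+\<omega>. h (\<lambda>i\<in>S \<times> UNIV. U i \<omega>) \<partial>M)
      = (\<integral>\<^sup>+z. h z \<partial>distr M (Pi\<^sub>M (S \<times> UNIV) (\<lambda>_. borel)) (\<lambda>\<omega>. \<lambda>i\<in>S \<times> UNIV. U i \<omega>))"
    by (simp add: nn_integral_distr)
  also have "\<dots> = (\<integral>\<^sup>+\<omega>. h (\<lambda>i\<in>S \<times> UNIV. V i \<omega>) \<partial>(M \<Otimes>\<^sub>M M))"
    unfolding law by (simp add: nn_integral_distr)
  also have "\<dots> = (\<integral>\<^sup>+\<omega>. \<integral>\<^sup>+\<omega>'. h (\<lambda>i\<in>S \<times> UNIV. V i (\<omega>, \<omega>')) \<partial>M \<partial>M)"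
    by (rule nn_integral_fst[symmetric]) measurable
  finally show ?thesis
    unfolding U_def V_def case_prod_unfold fst_conv snd_conv .
qed

end

section \<open>Maxima of correlated Gaussian families\<close>

text \<open>Jensen's inequality for the uniform distribution on \<open>{..<N}\<close>; it reduces a telescoping sum to its single steps.\<close>

lemma exp_mean_le:
  fixes D :: "nat \<Rightarrow> real"
  assumes "N > 0"
  shows "exp (\<Sum>i<N. D i) \<le> (\<Sum>i<N. exp (real N * D i)) / real N"
proof -
  have "exp (\<Sum>i<N. (1 / real N) *\<^sub>R (real N * D i)) \<le> (\<Sum>i<N. (1 / real N) * exp (real N * D i))"
    using assms by (intro convex_on_sum[OF _ _ exp_convex]) auto
  then show ?thesis using assms by (simp add: sum_divide_distrib)
qed

lemma exp_scale_le:
  fixes \<epsilon> x :: real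
  assumes "0 \<le> \<epsilon>" "\<epsilon> \<le> 1"
  shows "exp (\<epsilon> * x) \<le> 1 + \<epsilon> * exp x"
proof -
  have "exp ((1 - \<epsilon>) *\<^sub>R 0 + \<epsilon> *\<^sub>R x) \<le> (1 - \<epsilon>) * exp 0 + \<epsilon> * exp x"
    using assms by (intro convex_onD[OF exp_convex]) auto
  then show ?thesis using assms by simp
qed

context gaussian_linear_space
begin

lemma nn_integral_exp_le:
  assumes "X \<in> L" "expectation (\<lambda>\<omega>. (X \<omega>)\<^sup>2) \<le> v"
  shows "(\<integral>\<^sup>+\<omega>. ennreal (exp (c * X \<omega>)) \<partial>M) \<le> ennreal (exp (c\<^sup>2 * v / 2))"
  using nn_integral_exp[OF scale[OF assms(1), of c]] mult_left_mono[OF assms(2), of "c\<^sup>2"]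
  by (simp add: power_mult_distrib ennreal_leI)

lemma Max_measurable:
  assumes "finite S" "\<And>s. s \<in> S \<Longrightarrow> X s \<in> L"
  shows "(\<lambda>\<omega>. Max ((\<lambda>s. X s \<omega>) ` S)) \<in> borel_measurable M"
  using assms measurable by (intro borel_measurable_Max) auto

text \<open>The maximum need not be centered, but a vanishing multiple of it has an exponential moment tending to \<open>1\<close>. The
crude bound of the maximum by the sum over \<open>S\<close> enters only with the factor \<open>\<epsilon>\<close>.\<close>

lemma exp_Max_small_scale:
  assumes S: "finite S" "S \<noteq> {}" and X: "\<And>s. s \<in> S \<Longrightarrow> X s \<in> L"
    and v: "\<And>s. s \<in> S \<Longrightarrow> expectation (\<lambda>\<omega>. (X s \<omega>)\<^sup>2) \<le> v"
    and \<epsilon>: "0 \<le> \<epsilon>" "\<epsilon> \<le> 1"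
  shows "(\<integral>\<^sup>+\<omega>. ennreal (exp (\<epsilon> * Max ((\<lambda>s. X s \<omega>) ` S))) \<partial>M) \<le> ennreal (1 + \<epsilon> * (card S * exp (v / 2)))"
proof -
  have [measurable]: "X s \<in> borel_measurable M" if "s \<in> S" for s using X[OF that] measurable by blast
  have "(\<integral>\<^sup>+\<omega>. ennreal (exp (\<epsilon> * Max ((\<lambda>s. X s \<omega>) ` S))) \<partial>M)
    \<le> (\<integral>\<^sup>+\<omega>. 1 + ennreal \<epsilon> * (\<Sum>s\<in>S. ennreal (exp (1 * X s \<omega>))) \<partial>M)"
  proof (rule nn_integral_mono)
    fix \<omega>
    obtain s where s: "s \<in> S" "Max ((\<lambda>s. X s \<omega>) ` S) = X s \<omega>"
      using obtains_MAX[OF S, of "\<lambda>s. X s \<omega>"] by metis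
    have "exp (X s \<omega>) \<le> (\<Sum>s\<in>S. exp (X s \<omega>))"
      using s S by (intro member_le_sum) auto
    then have "exp (\<epsilon> * Max ((\<lambda>s. X s \<omega>) ` S)) \<le> 1 + \<epsilon> * (\<Sum>s\<in>S. exp (X s \<omega>))"
      using exp_scale_le[OF \<epsilon>, of "X s \<omega>"] mult_left_mono[OF _ \<epsilon>(1)] unfolding s(2) by fastforce
    then have "ennreal (exp (\<epsilon> * Max ((\<lambda>s. X s \<omega>) ` S))) \<le> ennreal (1 + \<epsilon> * (\<Sum>s\<in>S. exp (X s \<omega>)))"
      by (rule ennreal_leI)
    also have "\<dots> = 1 + ennreal \<epsilon> * (\<Sum>s\<in>S. ennreal (exp (1 * X s \<omega>)))"
      using \<epsilon> by (simp add: sum_nonneg ennreal_plus ennreal_mult sum_ennreal)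
    finally show "ennreal (exp (\<epsilon> * Max ((\<lambda>s. X s \<omega>) ` S))) \<le> 1 + ennreal \<epsilon> * (\<Sum>s\<in>S. ennreal (exp (1 * X s \<omega>)))" .
  qed
  also have "\<dots> = 1 + ennreal \<epsilon> * (\<Sum>s\<in>S. \<integral>\<^sup>+\<omega>. ennreal (exp (1 * X s \<omega>)) \<partial>M)"
    by (simp add: nn_integral_add nn_integral_cmult nn_integral_sum emeasure_space_1 sum_nonneg del: sum_ennreal)
  also have "\<dots> \<le> 1 + ennreal \<epsilon> * (\<Sum>s\<in>S. ennreal (exp (1\<^sup>2 * v / 2)))"
    using X v by (intro add_left_mono mult_left_mono sum_mono nn_integral_exp_le) auto
  also have "\<dots> = ennreal (1 + \<epsilon> * (card S * exp (v / 2)))"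
    using \<epsilon> by (simp add: ennreal_plus ennreal_mult ennreal_of_nat_eq_real_of_nat)
  finally show ?thesis .
qed

text \<open>One step of the rotation. Let \<open>s\<close> be a coordinate at which \<open>X\<close> is maximal. Replacing the second maximum by
its \<open>s\<close>-th entry bounds the difference by \<open>(1 - c) Max X + d Y\<^sub>s\<close>. Since \<open>Y\<close> is
independent of \<open>X\<close>, the choice of \<open>s\<close> does not bias \<open>Y\<^sub>s\<close>: after decoupling, the sample
point of \<open>X\<close> is fixed while \<open>Y\<close> is integrated, so \<open>s\<close> is a constant.\<close>

lemma exp_Max_decrement:
  assumes S: "finite S" "S \<noteq> {}" and X: "\<And>s. s \<in> S \<Longrightarrow> X s \<in> L" and Y: "\<And>s. s \<in> S \<Longrightarrow> Y s \<in> L"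
    and orth: "\<And>s s'. s \<in> S \<Longrightarrow> s' \<in> S \<Longrightarrow> expectation (\<lambda>\<omega>. X s \<omega> * Y s' \<omega>) = 0"
    and v: "\<And>s. s \<in> S \<Longrightarrow> expectation (\<lambda>\<omega>. (Y s \<omega>)\<^sup>2) \<le> v"
    and \<gamma>: "\<gamma> \<ge> 0"
  shows "(\<integral>\<^sup>+\<omega>. ennreal (exp (\<gamma> * (Max ((\<lambda>s. X s \<omega>) ` S) - Max ((\<lambda>s. c * X s \<omega> - d * Y s \<omega>) ` S)))) \<partial>M)
    \<le> (\<integral>\<^sup>+\<omega>. ennreal (exp (\<gamma> * (1 - c) * Max ((\<lambda>s. X s \<omega>) ` S))) \<partial>M) * ennreal (exp ((\<gamma> * d)\<^sup>2 * v / 2))"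
proof -
  define h where "h z = ennreal (exp (\<gamma> * (Max ((\<lambda>s. z (s, True)) ` S) - Max ((\<lambda>s. c * z (s, True) - d * z (s, False)) ` S))))"
    for z :: "'b \<times> bool \<Rightarrow> real"
  have hm: "h \<in> borel_measurable (Pi\<^sub>M (S \<times> UNIV) (\<lambda>_. borel))"
    unfolding h_def using S(1) by measurable
  note [measurable] = Max_measurable[OF S(1) X]
  have "(\<integral>\<^sup>+\<omega>. ennreal (exp (\<gamma> * (Max ((\<lambda>s. X s \<omega>) ` S) - Max ((\<lambda>s. c * X s \<omega> - d * Y s \<omega>) ` S)))) \<partial>M)
    = (\<integral>\<^sup>+\<omega>. h (\<lambda>(s, b)\<in>S \<times> UNIV. if b then X s \<omega> else Y s \<omega>) \<partial>M)"
    by (simp add: h_def cong: image_cong_simp)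
  also have "\<dots> = (\<integral>\<^sup>+\<omega>. \<integral>\<^sup>+\<omega>'. h (\<lambda>(s, b)\<in>S \<times> UNIV. if b then X s \<omega> else Y s \<omega>') \<partial>M \<partial>M)"
    by (rule nn_integral_decouple[OF S(1) X Y orth hm])
  also have "\<dots> \<le> (\<integral>\<^sup>+\<omega>. ennreal (exp (\<gamma> * (1 - c) * Max ((\<lambda>s. X s \<omega>) ` S))) * ennreal (exp ((\<gamma> * d)\<^sup>2 * v / 2)) \<partial>M)"
  proof (rule nn_integral_mono)
    fix \<omega>
    obtain s where s: "s \<in> S" "Max ((\<lambda>s. X s \<omega>) ` S) = X s \<omega>"
      using obtains_MAX[OF S, of "\<lambda>s. X s \<omega>"] by metis
    have [measurable]: "Y s \<in> borel_measurable M" using Y[OF s(1)] measurable by blast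
    have "(\<integral>\<^sup>+\<omega>'. h (\<lambda>(s, b)\<in>S \<times> UNIV. if b then X s \<omega> else Y s \<omega>') \<partial>M)
      \<le> (\<integral>\<^sup>+\<omega>'. ennreal (exp (\<gamma> * (1 - c) * X s \<omega>)) * ennreal (exp (\<gamma> * d * Y s \<omega>')) \<partial>M)"
    proof (rule nn_integral_mono)
      fix \<omega>'
      have "c * X s \<omega> - d * Y s \<omega>' \<le> Max ((\<lambda>s. c * X s \<omega> - d * Y s \<omega>') ` S)"
        using S s by (intro Max_ge) auto
      then have "Max ((\<lambda>s. X s \<omega>) ` S) - Max ((\<lambda>s. c * X s \<omega> - d * Y s \<omega>') ` S)
          \<le> (1 - c) * X s \<omega> + d * Y s \<omega>'"
        unfolding s(2) by (simp add: algebra_simps)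
      from mult_left_mono[OF this \<gamma>]
      have "exp (\<gamma> * (Max ((\<lambda>s. X s \<omega>) ` S) - Max ((\<lambda>s. c * X s \<omega> - d * Y s \<omega>') ` S)))
        \<le> exp (\<gamma> * (1 - c) * X s \<omega>) * exp (\<gamma> * d * Y s \<omega>')"
        unfolding exp_add[symmetric] by (simp add: distrib_left mult.assoc)
      then show "h (\<lambda>(s, b)\<in>S \<times> UNIV. if b then X s \<omega> else Y s \<omega>')
        \<le> ennreal (exp (\<gamma> * (1 - c) * X s \<omega>)) * ennreal (exp (\<gamma> * d * Y s \<omega>'))"
        unfolding h_def by (simp add: ennreal_mult[symmetric] ennreal_leI cong: image_cong_simp)
    qed
    also have "\<dots> = ennreal (exp (\<gamma> * (1 - c) * X s \<omega>)) * (\<integral>\<^sup>+\<omega>'. ennreal (exp (\<gamma> * d * Y s \<omega>')) \<partial>M)"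
      by (rule nn_integral_cmult) simp
    also have "\<dots> \<le> ennreal (exp (\<gamma> * (1 - c) * X s \<omega>)) * ennreal (exp ((\<gamma> * d)\<^sup>2 * v / 2))"
      using Y v s by (intro mult_left_mono nn_integral_exp_le) auto
    finally show "(\<integral>\<^sup>+\<omega>'. h (\<lambda>(s, b)\<in>S \<times> UNIV. if b then X s \<omega> else Y s \<omega>') \<partial>M)
      \<le> ennreal (exp (\<gamma> * (1 - c) * Max ((\<lambda>s. X s \<omega>) ` S))) * ennreal (exp ((\<gamma> * d)\<^sup>2 * v / 2))"
      unfolding s(2) .
  qed
  also have "\<dots> = (\<integral>\<^sup>+\<omega>. ennreal (exp (\<gamma> * (1 - c) * Max ((\<lambda>s. X s \<omega>) ` S))) \<partial>M) * ennreal (exp ((\<gamma> * d)\<^sup>2 * v / 2))"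
    by (rule nn_integral_multc) measurable
  finally show ?thesis .
qed

text \<open>The angle is divided into \<open>N\<close> steps of size \<open>\<delta> = \<phi> / N\<close>. By convexity it suffices to bound
each step with \<open>\<gamma>\<close> replaced by \<open>N \<gamma>\<close>. The noise then contributes
\<open>(N \<gamma> sin \<delta>)\<^sup>2 \<le> (\<gamma> \<phi>)\<^sup>2\<close>, while the drift coefficient
\<open>\<epsilon> = N \<gamma> (1 - cos \<delta>)\<close> is of order \<open>1 / N\<close> and disappears in the limit.\<close>

lemma exp_Max_rotation:
  assumes S: "finite S" "S \<noteq> {}" and V: "\<And>s. s \<in> S \<Longrightarrow> V s \<in> L" and W: "\<And>s. s \<in> S \<Longrightarrow> W s \<in> L"
    and cov: "\<And>s s'. s \<in> S \<Longrightarrow> s' \<in> S \<Longrightarrow> expectation (\<lambda>\<omega>. W s \<omega> * W s' \<omega>) = expectation (\<lambda>\<omega>. V s \<omega> * V s' \<omega>)"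
    and orth: "\<And>s s'. s \<in> S \<Longrightarrow> s' \<in> S \<Longrightarrow> expectation (\<lambda>\<omega>. V s \<omega> * W s' \<omega>) = 0"
    and v: "\<And>s. s \<in> S \<Longrightarrow> expectation (\<lambda>\<omega>. (V s \<omega>)\<^sup>2) \<le> v"
    and \<gamma>: "\<gamma> \<ge> 0" and \<phi>: "\<phi> \<ge> 0"
  shows "(\<integral>\<^sup>+\<omega>. ennreal (exp (\<gamma> * (Max ((\<lambda>s. cos \<phi> * V s \<omega> + sin \<phi> * W s \<omega>) ` S) - Max ((\<lambda>s. V s \<omega>) ` S)))) \<partial>M)
    \<le> ennreal (exp ((\<gamma> * \<phi>)\<^sup>2 * v / 2))"
proof -
  define Z where "Z \<theta> s \<omega> = cos \<theta> * V s \<omega> + sin \<theta> * W s \<omega>" for \<theta> s \<omega>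
  \<comment> \<open>\<open>Z'\<close> is the derivative of \<open>Z\<close> in the angle.\<close>
  define Z' where "Z' \<theta> s \<omega> = - sin \<theta> * V s \<omega> + cos \<theta> * W s \<omega>" for \<theta> s \<omega>
  define m where "m \<theta> \<omega> = Max ((\<lambda>s. Z \<theta> s \<omega>) ` S)" for \<theta> \<omega>
  have ZL: "Z \<theta> s \<in> L" "Z' \<theta> s \<in> L" if "s \<in> S" for \<theta> s
    unfolding Z_def Z'_def by (intro linear_combination V W that)+
  have orth': "expectation (\<lambda>\<omega>. W s \<omega> * V s' \<omega>) = 0" if "s \<in> S" "s' \<in> S" for s s'
    using orth[OF that(2,1)] by (simp add: mult.commute)
  have Zvar: "expectation (\<lambda>\<omega>. (Z \<theta> s \<omega>)\<^sup>2) \<le> v" "expectation (\<lambda>\<omega>. (Z' \<theta> s \<omega>)\<^sup>2) \<le> v" if s: "s \<in> S" for \<theta> s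
  proof -
    have *: "expectation (\<lambda>\<omega>. (a * V s \<omega> + b * W s \<omega>)\<^sup>2) \<le> v" if "a\<^sup>2 + b\<^sup>2 = 1" for a b
    proof -
      have "expectation (\<lambda>\<omega>. (a * V s \<omega> + b * W s \<omega>)\<^sup>2) = (a\<^sup>2 + b\<^sup>2) * expectation (\<lambda>\<omega>. (V s \<omega>)\<^sup>2)"
        unfolding power2_eq_square
        by (subst expectation_mult_linear) (auto simp: V W s orth orth' cov distrib_right)
      then show ?thesis using v[OF s] that by simp
    qed
    show "expectation (\<lambda>\<omega>. (Z \<theta> s \<omega>)\<^sup>2) \<le> v" "expectation (\<lambda>\<omega>. (Z' \<theta> s \<omega>)\<^sup>2) \<le> v"
      unfolding Z_def Z'_def by (rule *, simp)+
  qed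
  have Zorth: "expectation (\<lambda>\<omega>. Z \<theta> s \<omega> * Z' \<theta> s' \<omega>) = 0" if s: "s \<in> S" "s' \<in> S" for \<theta> s s'
    unfolding Z_def Z'_def
    by (subst expectation_mult_linear) (auto simp: V W s orth orth' cov)
  define B where "B = card S * exp (v / 2)"
  have B: "B \<ge> 0" by (simp add: B_def)
  define E where "E = exp ((\<gamma> * \<phi>)\<^sup>2 * v / 2)"
  have v0: "v \<ge> 0"
  proof -
    obtain s where "s \<in> S" using S by auto
    have "0 \<le> expectation (\<lambda>\<omega>. (V s \<omega>)\<^sup>2)" by simp
    then show ?thesis using v[OF \<open>s \<in> S\<close>] by linarith
  qed
  have mm[measurable]: "m \<theta> \<in> borel_measurable M" for \<theta>
    unfolding m_def using ZL S by (intro Max_measurable) auto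
  have bound: "(\<integral>\<^sup>+\<omega>. ennreal (exp (\<gamma> * (m \<phi> \<omega> - m 0 \<omega>))) \<partial>M) \<le> ennreal ((1 + (\<gamma> * \<phi>\<^sup>2 * B / 2) / real N) * E)"
    if N: "N > 0" "\<gamma> * \<phi>\<^sup>2 / 2 \<le> real N" for N
  proof -
    define \<delta> where "\<delta> = \<phi> / real N"
    define \<epsilon> where "\<epsilon> = real N * \<gamma> * (1 - cos \<delta>)"
    have \<delta>: "\<delta> \<ge> 0" "real N * \<delta> = \<phi>" using N \<phi> by (auto simp: \<delta>_def)
    have "1 - cos \<delta> \<le> \<delta>\<^sup>2 / 2"
    proof -
      have "1 - cos \<delta> = 2 * (sin (\<delta> / 2))\<^sup>2"
        using cos_double_sin[of "\<delta> / 2"] by simp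
      also have "(sin (\<delta> / 2))\<^sup>2 \<le> (\<delta> / 2)\<^sup>2"
        by (rule abs_le_square_iff[THEN iffD1]) (rule abs_sin_x_le_abs_x)
      finally show ?thesis by (simp add: power2_eq_square)
    qed
    then have "\<epsilon> \<le> real N * \<gamma> * (\<delta>\<^sup>2 / 2)"
      unfolding \<epsilon>_def using \<gamma> by (intro mult_left_mono) auto
    also have "\<dots> = \<gamma> * \<phi>\<^sup>2 / 2 / real N"
      using N by (simp add: \<delta>_def power2_eq_square field_simps)
    finally have \<epsilon>_le: "\<epsilon> \<le> \<gamma> * \<phi>\<^sup>2 / 2 / real N" .
    have \<epsilon>0: "\<epsilon> \<ge> 0" unfolding \<epsilon>_def using \<gamma> by simp
    have \<epsilon>1: "\<epsilon> \<le> 1"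
    proof -
      have "\<gamma> * \<phi>\<^sup>2 / 2 / real N \<le> 1" using N by simp
      with \<epsilon>_le show ?thesis by (rule order_trans)
    qed
    define D where "D i \<omega> = \<gamma> * (m (real (Suc i) * \<delta>) \<omega> - m (real i * \<delta>) \<omega>)" for i \<omega>
    have Dm[measurable]: "D i \<in> borel_measurable M" for i unfolding D_def by measurable
    have tel: "(\<Sum>i<N. D i \<omega>) = \<gamma> * (m \<phi> \<omega> - m 0 \<omega>)" for \<omega>
      unfolding D_def sum_distrib_left[symmetric]
      using sum_lessThan_telescope[of "\<lambda>i. m (real i * \<delta>) \<omega>" N] \<delta>(2) by simp
    have step: "(\<integral>\<^sup>+\<omega>. ennreal (exp (real N * D i \<omega>)) \<partial>M) \<le> ennreal (1 + \<epsilon> * B) * ennreal E" for i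
    proof -
      let ?t = "real (Suc i) * \<delta>"
      have angle: "real i * \<delta> = ?t - \<delta>" by (simp add: algebra_simps)
      have previous: "Z (real i * \<delta>) s \<omega> = cos \<delta> * Z ?t s \<omega> - sin \<delta> * Z' ?t s \<omega>" for s \<omega>
        unfolding Z_def Z'_def angle cos_diff sin_diff by (simp add: algebra_simps)
      have "(\<integral>\<^sup>+\<omega>. ennreal (exp (real N * D i \<omega>)) \<partial>M) = (\<integral>\<^sup>+\<omega>. ennreal (exp ((real N * \<gamma>) *
         (Max ((\<lambda>s. Z ?t s \<omega>) ` S) - Max ((\<lambda>s. cos \<delta> * Z ?t s \<omega> - sin \<delta> * Z' ?t s \<omega>) ` S)))) \<partial>M)"
        unfolding D_def m_def previous[symmetric] mult.assoc ..
      also have "\<dots> \<le> (\<integral>\<^sup>+\<omega>. ennreal (exp ((real N * \<gamma>) * (1 - cos \<delta>) * Max ((\<lambda>s. Z ?t s \<omega>) ` S))) \<partial>M)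
          * ennreal (exp (((real N * \<gamma>) * sin \<delta>)\<^sup>2 * v / 2))"
        using \<gamma> by (intro exp_Max_decrement[OF S ZL(1) ZL(2) Zorth Zvar(2)]) auto
      also have "\<dots> \<le> ennreal (1 + \<epsilon> * B) * ennreal E"
      proof (rule mult_mono)
        show "(\<integral>\<^sup>+\<omega>. ennreal (exp ((real N * \<gamma>) * (1 - cos \<delta>) * Max ((\<lambda>s. Z ?t s \<omega>) ` S))) \<partial>M) \<le> ennreal (1 + \<epsilon> * B)"
          unfolding \<epsilon>_def[symmetric] B_def by (intro exp_Max_small_scale[OF S ZL(1) Zvar(1) \<epsilon>0 \<epsilon>1])
        have "\<bar>real N * \<gamma> * sin \<delta>\<bar> \<le> \<bar>\<gamma> * \<phi>\<bar>"
          using mult_left_mono[OF abs_sin_x_le_abs_x[of \<delta>], of "real N * \<gamma>"] \<gamma> \<delta> \<phi>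
          by (simp add: abs_mult mult.assoc mult.left_commute)
        then have "(real N * \<gamma> * sin \<delta>)\<^sup>2 \<le> (\<gamma> * \<phi>)\<^sup>2"
          by (simp only: abs_le_square_iff)
        then show "ennreal (exp (((real N * \<gamma>) * sin \<delta>)\<^sup>2 * v / 2)) \<le> ennreal E"
          unfolding E_def using v0 by (intro ennreal_leI) (simp add: mult_right_mono)
      qed auto
      finally show ?thesis .
    qed
    have "(\<integral>\<^sup>+\<omega>. ennreal (exp (\<gamma> * (m \<phi> \<omega> - m 0 \<omega>))) \<partial>M)
      \<le> (\<integral>\<^sup>+\<omega>. (\<Sum>i<N. ennreal (exp (real N * D i \<omega>))) * ennreal (1 / real N) \<partial>M)"
    proof (rule nn_integral_mono)
      fix \<omega>
      show "ennreal (exp (\<gamma> * (m \<phi> \<omega> - m 0 \<omega>))) \<le> (\<Sum>i<N. ennreal (exp (real N * D i \<omega>))) * ennreal (1 / real N)"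
        using exp_mean_le[OF N(1), of "\<lambda>i. D i \<omega>"]
        unfolding tel by (simp add: ennreal_mult[symmetric] sum_nonneg ennreal_leI sum_ennreal)
    qed
    also have "\<dots> = (\<Sum>i<N. \<integral>\<^sup>+\<omega>. ennreal (exp (real N * D i \<omega>)) \<partial>M) * ennreal (1 / real N)"
      by (simp add: nn_integral_multc nn_integral_sum del: sum_ennreal)
    also have "\<dots> \<le> (\<Sum>i<N. ennreal (1 + \<epsilon> * B) * ennreal E) * ennreal (1 / real N)"
      by (intro mult_right_mono sum_mono step) simp
    also have "\<dots> = ennreal ((1 + \<epsilon> * B) * E)"
      using N \<epsilon>0 B unfolding E_def
      by (simp add: ennreal_mult[symmetric] ennreal_of_nat_eq_real_of_nat del: ennreal_plus)
    also have "\<dots> \<le> ennreal ((1 + (\<gamma> * \<phi>\<^sup>2 * B / 2) / real N) * E)"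
      using mult_right_mono[OF \<epsilon>_le B] by (intro ennreal_leI mult_right_mono) (auto simp: E_def)
    finally show ?thesis .
  qed
  have "(\<lambda>N. (1 + (\<gamma> * \<phi>\<^sup>2 * B / 2) / real N) * E) \<longlonglongrightarrow> (1 + 0) * E"
    by (intro tendsto_intros lim_const_over_n)
  then have lim: "(\<lambda>N. ennreal ((1 + (\<gamma> * \<phi>\<^sup>2 * B / 2) / real N) * E)) \<longlonglongrightarrow> ennreal E"
    by (auto intro: tendsto_ennrealI)
  have "(\<integral>\<^sup>+\<omega>. ennreal (exp (\<gamma> * (m \<phi> \<omega> - m 0 \<omega>))) \<partial>M) \<le> ennreal E"
  proof (rule LIMSEQ_le_const[OF lim], intro exI allI impI)
    fix N assume N: "max 1 (nat \<lceil>\<gamma> * \<phi>\<^sup>2 / 2\<rceil>) \<le> N"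
    then have "\<gamma> * \<phi>\<^sup>2 / 2 \<le> real N" by linarith
    then show "(\<integral>\<^sup>+\<omega>. ennreal (exp (\<gamma> * (m \<phi> \<omega> - m 0 \<omega>))) \<partial>M)
        \<le> ennreal ((1 + (\<gamma> * \<phi>\<^sup>2 * B / 2) / real N) * E)"
      using bound N by simp
  qed
  then show ?thesis by (simp add: m_def Z_def E_def)
qed

text \<open>Two families with the same covariances and correlation \<open>cos \<phi>\<close> are the ends of a rotation by \<open>\<phi>\<close>:
the independent copy \<open>W\<close> is the normalised part of \<open>U\<close> orthogonal to \<open>V\<close>.\<close>

theorem exp_Max_correlated:
  assumes S: "finite S" "S \<noteq> {}" and U: "\<And>s. s \<in> S \<Longrightarrow> U s \<in> L" and V: "\<And>s. s \<in> S \<Longrightarrow> V s \<in> L"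
    and cov: "\<And>s s'. s \<in> S \<Longrightarrow> s' \<in> S \<Longrightarrow> expectation (\<lambda>\<omega>. U s \<omega> * U s' \<omega>) = expectation (\<lambda>\<omega>. V s \<omega> * V s' \<omega>)"
    and cross: "\<And>s s'. s \<in> S \<Longrightarrow> s' \<in> S \<Longrightarrow> expectation (\<lambda>\<omega>. U s \<omega> * V s' \<omega>) = cos \<phi> * expectation (\<lambda>\<omega>. V s \<omega> * V s' \<omega>)"
    and v: "\<And>s. s \<in> S \<Longrightarrow> expectation (\<lambda>\<omega>. (V s \<omega>)\<^sup>2) \<le> v"
    and \<gamma>: "\<gamma> \<ge> 0" and \<phi>: "0 < \<phi>" "\<phi> < pi"
  shows "(\<integral>\<^sup>+\<omega>. ennreal (exp (\<gamma> * (Max ((\<lambda>s. U s \<omega>) ` S) - Max ((\<lambda>s. V s \<omega>) ` S)))) \<partial>M)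
    \<le> ennreal (exp ((\<gamma> * \<phi>)\<^sup>2 * v / 2))"
proof -
  have s0: "sin \<phi> \<noteq> 0" using sin_gt_zero[OF \<phi>] by simp
  define W where "W s \<omega> = (1 / sin \<phi>) * U s \<omega> + (- cos \<phi> / sin \<phi>) * V s \<omega>" for s \<omega>
  have W: "W s \<in> L" if "s \<in> S" for s
    unfolding W_def using U[OF that] V[OF that] by (rule linear_combination)
  have cross': "expectation (\<lambda>\<omega>. V s \<omega> * U s' \<omega>) = cos \<phi> * expectation (\<lambda>\<omega>. V s \<omega> * V s' \<omega>)" if "s \<in> S" "s' \<in> S" for s s'
    using cross[OF that(2,1)] by (simp add: mult.commute)
  have "expectation (\<lambda>\<omega>. W s \<omega> * W s' \<omega>) = expectation (\<lambda>\<omega>. V s \<omega> * V s' \<omega>)" if s: "s \<in> S" "s' \<in> S" for s s'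
  proof -
    have "expectation (\<lambda>\<omega>. W s \<omega> * W s' \<omega>)
      = ((1 - (cos \<phi>)\<^sup>2) / (sin \<phi>)\<^sup>2) * expectation (\<lambda>\<omega>. V s \<omega> * V s' \<omega>)"
      unfolding W_def
      by (subst expectation_mult_linear)
         (use s0 in \<open>auto simp: U V s cov cross cross' power2_eq_square field_simps\<close>)
    then show ?thesis using s0 by (simp add: sin_squared_eq[symmetric])
  qed
  moreover have "expectation (\<lambda>\<omega>. V s \<omega> * W s' \<omega>) = 0" if s: "s \<in> S" "s' \<in> S" for s s'
    using expectation_mult_linear[OF V[OF s(1)] V[OF s(1)] U[OF s(2)] V[OF s(2)], of 1 0 "1 / sin \<phi>" "- cos \<phi> / sin \<phi>"]
    by (simp add: W_def cross' s)
  ultimately have "(\<integral>\<^sup>+\<omega>. ennreal (exp (\<gamma> * (Max ((\<lambda>s. cos \<phi> * V s \<omega> + sin \<phi> * W s \<omega>) ` S) - Max ((\<lambda>s. V s \<omega>) ` S)))) \<partial>M)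
    \<le> ennreal (exp ((\<gamma> * \<phi>)\<^sup>2 * v / 2))"
    using \<phi> by (intro exp_Max_rotation[OF S V W _ _ v \<gamma>]) auto
  moreover have "cos \<phi> * V s \<omega> + sin \<phi> * W s \<omega> = U s \<omega>" for s \<omega>
    using s0 by (simp add: W_def field_simps)
  ultimately show ?thesis by simp
qed

end

section \<open>Tails and moments from exponential moments\<close>

lemma powr_le_exp:
  fixes x k :: real
  assumes "x \<ge> 0" "k > 0"
  shows "(x / k) powr k \<le> exp x"
proof -
  have "x / k \<le> exp (x / k)" using exp_ge_add_one_self[of "x / k"] by linarith
  then have "(x / k) powr k \<le> exp (x / k) powr k"
    using assms by (intro powr_mono2) auto
  also have "\<dots> = exp x" using assms by (simp add: powr_def)
  finally show ?thesis .
qed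

text \<open>From \<open>1 - cos \<phi> = 2 (sin (\<phi> / 2))\<^sup>2\<close> and \<open>sin y \<ge> y / 2\<close> on \<open>[0, \<pi>/4]\<close>.\<close>

lemma square_le_one_minus_cos:
  assumes "0 \<le> \<phi>" "\<phi> \<le> pi / 2"
  shows "\<phi>\<^sup>2 \<le> 8 * (1 - cos \<phi>)"
proof -
  have "sin 0 - 0 / 2 \<le> sin (\<phi> / 2) - (\<phi> / 2) / 2"
  proof (rule DERIV_nonneg_imp_nondecreasing[where f = "\<lambda>y. sin y - y / 2"])
    show "0 \<le> \<phi> / 2" using assms by simp
    fix y assume y: "0 \<le> y" "y \<le> \<phi> / 2"
    have "cos (pi / 3) \<le> cos y" using y assms by (intro cos_monotone_0_pi_le) auto
    then show "\<exists>d. DERIV (\<lambda>y. sin y - y / 2) y :> d \<and> 0 \<le> d"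
      by (intro exI[of _ "cos y - 1 / 2"]) (auto intro!: derivative_eq_intros simp: cos_60)
  qed
  then have "(\<phi> / 4)\<^sup>2 \<le> (sin (\<phi> / 2))\<^sup>2"
    using assms by (intro power_mono) auto
  moreover have "1 - cos \<phi> = 2 * (sin (\<phi> / 2))\<^sup>2"
    using cos_double_sin[of "\<phi> / 2"] by simp
  ultimately show ?thesis by (simp add: power2_eq_square)
qed

context prob_space
begin

text \<open>Chernoff's bound at the threshold \<open>4 * sqrt (v * u)\<close>, where \<open>\<gamma>\<close> is the minimiser of
\<open>4 * \<gamma>\<^sup>2 * v - \<gamma> * (4 * sqrt (v * u))\<close>, whose minimum is \<open>- u\<close>.\<close>

lemma subgaussian_tail:
  assumes [measurable]: "D \<in> borel_measurable M" and v: "v > 0" and u: "u > 0"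
    and mgf: "\<And>\<gamma>. \<gamma> \<ge> 0 \<Longrightarrow> (\<integral>\<^sup>+\<omega>. ennreal (exp (\<gamma> * \<bar>D \<omega>\<bar>)) \<partial>M) \<le> ennreal (2 * exp (4 * \<gamma>\<^sup>2 * v))"
    and c: "c \<ge> 4"
  shows "prob {\<omega> \<in> space M. \<bar>D \<omega>\<bar> > c * sqrt (v * u)} \<le> 2 * exp (- u)"
proof -
  define \<gamma> where "\<gamma> = sqrt (u / v) / 2"
  have \<gamma>: "\<gamma> > 0" "4 * \<gamma>\<^sup>2 * v = u" using u v by (auto simp: \<gamma>_def power_divide)
  have "sqrt (u / v) * sqrt (v * u) = sqrt (u * u)"
    using v by (simp add: real_sqrt_mult[symmetric] del: real_sqrt_mult_self)
  then have s: "\<gamma> * (4 * sqrt (v * u)) = 2 * u"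
    using u by (simp add: \<gamma>_def mult.commute)
  have "4 * sqrt (v * u) \<le> c * sqrt (v * u)" using c u v by (intro mult_right_mono) auto
  then have "emeasure M {\<omega> \<in> space M. \<bar>D \<omega>\<bar> > c * sqrt (v * u)} \<le> emeasure M {\<omega> \<in> space M. \<bar>D \<omega>\<bar> \<ge> 4 * sqrt (v * u)}"
    by (intro emeasure_mono) auto
  also have "\<dots> \<le> ennreal (exp (- \<gamma> * (4 * sqrt (v * u)))) *
      (\<integral>\<^sup>+\<omega>. ennreal (exp (\<gamma> * \<bar>D \<omega>\<bar>)) * indicator (space M) \<omega> \<partial>M)"
    using \<gamma>(1) by (intro Chernoff_ineq_nn_integral_ge) auto
  also have "(\<integral>\<^sup>+\<omega>. ennreal (exp (\<gamma> * \<bar>D \<omega>\<bar>)) * indicator (space M) \<omega> \<partial>M) = (\<integral>\<^sup>+\<omega>. ennreal (exp (\<gamma> * \<bar>D \<omega>\<bar>)) \<partial>M)"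
    by (rule nn_integral_cong) simp
  also have "ennreal (exp (- \<gamma> * (4 * sqrt (v * u)))) * \<dots> \<le> ennreal (exp (- (2 * u))) * ennreal (2 * exp u)"
    using mgf[of \<gamma>] \<gamma>(1) unfolding \<gamma>(2) mult_minus_left s by (intro mult_left_mono) auto
  also have "\<dots> = ennreal (2 * exp (- u))"
    by (simp add: ennreal_mult[symmetric] exp_add[symmetric])
  finally show ?thesis by (simp add: emeasure_eq_measure)
qed

text \<open>The power is dominated by an exponential, \<open>(\<gamma> x / k)\<^sup>k \<le> exp (\<gamma> x)\<close>, and \<open>\<gamma>\<close> is taken
of order \<open>sqrt (k / v)\<close>, which makes the exponential moment of order \<open>exp (k / 2)\<close>. The constant is
\<open>sqrt (16 e) \<le> 7\<close>.\<close>

lemma subgaussian_moments: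
  assumes [measurable]: "D \<in> borel_measurable M" and v: "v > 0" and k: "k \<ge> 2"
    and mgf: "\<And>\<gamma>. \<gamma> \<ge> 0 \<Longrightarrow> (\<integral>\<^sup>+\<omega>. ennreal (exp (\<gamma> * \<bar>D \<omega>\<bar>)) \<partial>M) \<le> ennreal (2 * exp (4 * \<gamma>\<^sup>2 * v))"
  shows "integrable M (\<lambda>\<omega>. \<bar>D \<omega>\<bar> powr k)"
    and "Lp_norm M k D \<le> 7 * sqrt (k * v)"
proof -
  define a where "a = sqrt (8 * k * v)"
  define \<gamma> where "\<gamma> = k / a"
  have a: "a > 0" using k v by (simp add: a_def)
  have \<gamma>: "\<gamma> > 0" using a k by (simp add: \<gamma>_def)
  have \<gamma>2: "4 * \<gamma>\<^sup>2 * v = k / 2"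
    using k v by (simp add: \<gamma>_def a_def power_divide power2_eq_square field_simps)
  have pt: "\<bar>D \<omega>\<bar> powr k \<le> a powr k * exp (\<gamma> * \<bar>D \<omega>\<bar>)" for \<omega>
  proof -
    have "\<bar>D \<omega>\<bar> = a * (\<gamma> * \<bar>D \<omega>\<bar> / k)" using a k by (simp add: \<gamma>_def)
    then have "\<bar>D \<omega>\<bar> powr k = a powr k * (\<gamma> * \<bar>D \<omega>\<bar> / k) powr k"
      using a k \<gamma> by (metis powr_mult)
    also have "\<dots> \<le> a powr k * exp (\<gamma> * \<bar>D \<omega>\<bar>)"
      using powr_le_exp[of "\<gamma> * \<bar>D \<omega>\<bar>" k] \<gamma> k by (intro mult_left_mono) auto
    finally show ?thesis .
  qed
  have bound: "(\<integral>\<^sup>+\<omega>. ennreal (\<bar>D \<omega>\<bar> powr k) \<partial>M) \<le> ennreal (2 * (a powr k * exp (k / 2)))"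
  proof -
    have "(\<integral>\<^sup>+\<omega>. ennreal (\<bar>D \<omega>\<bar> powr k) \<partial>M) \<le> (\<integral>\<^sup>+\<omega>. ennreal (a powr k) * ennreal (exp (\<gamma> * \<bar>D \<omega>\<bar>)) \<partial>M)"
      using pt by (intro nn_integral_mono) (simp add: ennreal_mult[symmetric] ennreal_leI)
    also have "\<dots> = ennreal (a powr k) * (\<integral>\<^sup>+\<omega>. ennreal (exp (\<gamma> * \<bar>D \<omega>\<bar>)) \<partial>M)"
      by (rule nn_integral_cmult) measurable
    also have "\<dots> \<le> ennreal (a powr k) * ennreal (2 * exp (k / 2))"
      using mgf[of \<gamma>] \<gamma> unfolding \<gamma>2 by (intro mult_left_mono) auto
    finally show ?thesis by (simp add: ennreal_mult[symmetric] mult_ac)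
  qed
  then show int: "integrable M (\<lambda>\<omega>. \<bar>D \<omega>\<bar> powr k)"
    by (intro integrableI_bounded) (auto simp: le_less_trans)
  have "ennreal (LINT \<omega>|M. \<bar>D \<omega>\<bar> powr k) \<le> ennreal (2 * (a powr k * exp (k / 2)))"
    using nn_integral_eq_integral[OF int] bound by simp
  then have "(LINT \<omega>|M. \<bar>D \<omega>\<bar> powr k) \<le> 2 * (a powr k * exp (k / 2))"
    by (subst (asm) ennreal_le_iff) auto
  also have "\<dots> \<le> (sqrt 2) powr k * (a powr k * (exp (1 / 2)) powr k)"
  proof -
    \<comment> \<open>Since \<open>k \<ge> 2\<close>, the factor \<open>2\<close> costs at most \<open>sqrt 2\<close> after taking the \<open>k\<close>-th root.\<close>
    have "(2::real) = sqrt 2 powr 2" by simp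
    also have "\<dots> \<le> sqrt 2 powr k" using k by (intro powr_mono) auto
    finally have "2 * (a powr k * exp (k / 2)) \<le> sqrt 2 powr k * (a powr k * exp (k / 2))"
      by (intro mult_right_mono) auto
    moreover have "exp (k / 2) = exp (1 / 2) powr k" by (simp add: powr_def)
    ultimately show ?thesis by simp
  qed
  also have "\<dots> = (sqrt 2 * (a * exp (1 / 2))) powr k"
    using a by (simp add: powr_mult)
  finally have "Lp_norm M k D \<le> ((sqrt 2 * (a * exp (1 / 2))) powr k) powr (1 / k)"
    unfolding Lp_norm_def using k by (intro powr_mono2) auto
  also have "\<dots> = sqrt 2 * (a * exp (1 / 2))"
    using a k by (simp add: powr_powr)
  also have "\<dots> = sqrt (16 * exp 1) * sqrt (k * v)"
  proof -
    have "exp (1 / 2) = sqrt (exp 1 :: real)"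
      by (rule real_sqrt_unique[symmetric]) (auto simp: power2_eq_square exp_add[symmetric])
    then show ?thesis by (simp add: a_def real_sqrt_mult[symmetric] mult_ac)
  qed
  also have "\<dots> \<le> 7 * sqrt (k * v)"
  proof (rule mult_right_mono)
    have "16 * exp 1 \<le> (7::real)\<^sup>2" using exp_le by simp
    then show "sqrt (16 * exp 1) \<le> 7" by (rule real_le_lsqrt[rotated -1]) auto
  qed (use k v in auto)
  finally show "Lp_norm M k D \<le> 7 * sqrt (k * v)" .
qed

end

section \<open>Passage times as limits of finite maxima\<close>

lemma staircase_endpoints:
  assumes "\<xi> \<in> staircases (0, 0) (real n, int n)"
  shows "\<xi> (- 1) = 0" "\<xi> (int n) = real n" "\<And>j. 0 \<le> j \<Longrightarrow> j \<le> int n \<Longrightarrow> \<xi> (j - 1) \<le> \<xi> j"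
  using assms by (simp_all add: staircases_def)

lemma staircase_mono:
  assumes \<xi>: "\<xi> \<in> staircases (0, 0) (real n, int n)" and "- 1 \<le> i" "i \<le> j" "j \<le> int n"
  shows "\<xi> i \<le> \<xi> j"
  using \<open>i \<le> j\<close> \<open>j \<le> int n\<close>
proof (induction j rule: int_ge_induct)
  case (step j)
  then have "\<xi> i \<le> \<xi> j" by simp
  also have "\<dots> \<le> \<xi> (j + 1)"
    using staircase_endpoints(3)[OF \<xi>, of "j + 1"] step \<open>- 1 \<le> i\<close> by simp
  finally show ?case .
qed simp

lemma staircase_range:
  assumes \<xi>: "\<xi> \<in> staircases (0, 0) (real n, int n)" and "- 1 \<le> j" "j \<le> int n"
  shows "0 \<le> \<xi> j" "\<xi> j \<le> real n"
  using staircase_mono[OF \<xi>, of "- 1" j] staircase_mono[OF \<xi>, of j "int n"] staircase_endpoints[OF \<xi>] assms by auto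

text \<open>A countable set of staircases, dense for pointwise convergence on the rows \<open>{- 1..n}\<close>. Fixing the default value
outside these rows makes it countable.\<close>

definition rational_staircases :: "nat \<Rightarrow> (int \<Rightarrow> real) set" where
  "rational_staircases n = staircases (0, 0) (real n, int n) \<inter> (\<Pi>\<^sub>E j\<in>{- 1..int n}. \<rat>)"

lemma countable_rational_staircases: "countable (rational_staircases n)"
  unfolding rational_staircases_def
  by (intro countable_Int2 countable_PiE) (auto simp: countable_rat)

text \<open>Rounding down to multiples of \<open>1 / m\<close> is monotone, and it fixes both endpoints \<open>0\<close> and \<open>n\<close>
because they are integers.\<close>

lemma round_down_rational_staircase:
  assumes \<xi>: "\<xi> \<in> staircases (0, 0) (real n, int n)" and m: "m > 0"
  shows "(\<lambda>j\<in>{- 1..int n}. of_int \<lfloor>real m * \<xi> j\<rfloor> / real m) \<in> rational_staircases n"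
proof -
  have "\<lfloor>real m * real n\<rfloor> = int (m * n)" by (metis floor_of_nat of_nat_mult)
  then have "real_of_int \<lfloor>real m * real n\<rfloor> / real m = real n" using m by simp
  moreover have "real_of_int \<lfloor>real m * \<xi> (j - 1)\<rfloor> / real m \<le> real_of_int \<lfloor>real m * \<xi> j\<rfloor> / real m"
    if "0 \<le> j" "j \<le> int n" for j
    using staircase_endpoints(3)[OF \<xi> that]
    by (intro divide_right_mono of_int_le_iff[THEN iffD2] floor_mono mult_left_mono) auto
  ultimately show ?thesis
    using staircase_endpoints[OF \<xi>]
    by (auto simp: rational_staircases_def staircases_def)
qed

lemma tendsto_round_down: "(\<lambda>m. of_int \<lfloor>real (Suc m) * x\<rfloor> / real (Suc m)) \<longlonglongrightarrow> x"
proof (rule real_tendsto_sandwich[where f = "\<lambda>m. x - 1 / real (Suc m)" and h = "\<lambda>_. x"])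
  have *: "x - 1 / real (Suc m) \<le> of_int \<lfloor>real (Suc m) * x\<rfloor> / real (Suc m)"
      "of_int \<lfloor>real (Suc m) * x\<rfloor> / real (Suc m) \<le> x" for m
  proof -
    have "real (Suc m) * x - 1 \<le> of_int \<lfloor>real (Suc m) * x\<rfloor>" "of_int \<lfloor>real (Suc m) * x\<rfloor> \<le> real (Suc m) * x"
      by linarith+
    then have "(real (Suc m) * x - 1) / real (Suc m) \<le> of_int \<lfloor>real (Suc m) * x\<rfloor> / real (Suc m)"
      "of_int \<lfloor>real (Suc m) * x\<rfloor> / real (Suc m) \<le> (real (Suc m) * x) / real (Suc m)"
      by (intro divide_right_mono; simp)+
    then show "x - 1 / real (Suc m) \<le> of_int \<lfloor>real (Suc m) * x\<rfloor> / real (Suc m)"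
      "of_int \<lfloor>real (Suc m) * x\<rfloor> / real (Suc m) \<le> x"
      by (simp_all only: diff_divide_distrib nonzero_mult_div_cancel_left of_nat_eq_0_iff nat.distinct not_False_eq_True)
  qed
  show "\<forall>\<^sub>F m in sequentially. x - 1 / real (Suc m) \<le> of_int \<lfloor>real (Suc m) * x\<rfloor> / real (Suc m)"
    "\<forall>\<^sub>F m in sequentially. of_int \<lfloor>real (Suc m) * x\<rfloor> / real (Suc m) \<le> x"
    using * by simp_all
  show "(\<lambda>m. x - 1 / real (Suc m)) \<longlonglongrightarrow> x"
    using tendsto_diff[OF tendsto_const LIMSEQ_inverse_real_of_nat, of x] by (simp add: inverse_eq_divide)
qed simp

lemma rational_staircases_nonempty: "rational_staircases n \<noteq> {}"
proof -
  have "(\<lambda>j. if j = - 1 then 0 else real n) \<in> staircases (0, 0) (real n, int n)"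
    by (auto simp: staircases_def)
  from round_down_rational_staircase[OF this, of 1] show ?thesis by auto
qed

lemma staircase_weight_bdd_above:
  assumes b: "\<And>j. continuous_on UNIV (b j)"
  shows "bdd_above (staircase_weight b (0, 0) (real n, int n) ` staircases (0, 0) (real n, int n))"
proof -
  have "\<exists>C. \<forall>x\<in>{0..real n}. \<bar>b j x\<bar> \<le> C" for j
  proof -
    have "compact (b j ` {0..real n})"
      using b continuous_on_subset by (intro compact_continuous_image) blast+
    from compact_imp_bounded[OF this] show ?thesis
      by (auto simp: bounded_iff)
  qed
  then obtain C where C: "\<And>j x. 0 \<le> x \<Longrightarrow> x \<le> real n \<Longrightarrow> \<bar>b j x\<bar> \<le> C j"
    by (metis atLeastAtMost_iff)
  show ?thesis
  proof (rule bdd_aboveI2)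
    fix \<xi> assume \<xi>: "\<xi> \<in> staircases (0, 0) (real n, int n)"
    show "staircase_weight b (0, 0) (real n, int n) \<xi> \<le> (\<Sum>j\<in>{0..int n}. 2 * C j)"
      unfolding staircase_weight_def fst_conv snd_conv
    proof (rule sum_mono)
      fix j assume "j \<in> {0..int n}"
      then show "b j (\<xi> j) - b j (\<xi> (j - 1)) \<le> 2 * C j"
        using C[of "\<xi> j" j] C[of "\<xi> (j - 1)" j] staircase_range[OF \<xi>, of j] staircase_range[OF \<xi>, of "j - 1"]
        by auto
    qed
  qed
qed

text \<open>The weight of a staircase depends continuously on its jump positions, so its supremum over the dense countable set is the
supremum over all staircases, and the maxima over initial segments of an enumeration increase to it.\<close>

lemma Max_rational_staircases_tendsto:
  fixes n :: nat
  assumes b: "\<And>j. continuous_on UNIV (b j)"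
  defines "w \<equiv> staircase_weight b (0, 0) (real n, int n)"
  shows "(\<lambda>m. Max ((\<lambda>i. w (from_nat_into (rational_staircases n) i)) ` {..m}))
    \<longlonglongrightarrow> (SUP \<xi>\<in>staircases (0, 0) (real n, int n). w \<xi>)"
proof (rule order_tendstoI)
  let ?S = "staircases (0, 0) (real n, int n)" and ?\<zeta> = "from_nat_into (rational_staircases n)"
  have bdd: "bdd_above (w ` ?S)" unfolding w_def by (rule staircase_weight_bdd_above[OF b])
  have \<zeta>S: "?\<zeta> i \<in> ?S" for i
    using from_nat_into[OF rational_staircases_nonempty] by (auto simp: rational_staircases_def)
  {
    fix a assume "(SUP \<xi>\<in>?S. w \<xi>) < a"
    moreover have "Max ((\<lambda>i. w (?\<zeta> i)) ` {..m}) \<le> (SUP \<xi>\<in>?S. w \<xi>)" for m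
      using \<zeta>S bdd by (intro Max.boundedI) (auto intro: cSUP_upper)
    ultimately show "\<forall>\<^sub>F m in sequentially. Max ((\<lambda>i. w (?\<zeta> i)) ` {..m}) < a"
      by (intro always_eventually allI) (rule le_less_trans)
  next
    fix a assume a: "a < (SUP \<xi>\<in>?S. w \<xi>)"
    have "?S \<noteq> {}" using \<zeta>S by blast
    then obtain \<xi> where \<xi>: "\<xi> \<in> ?S" "a < w \<xi>"
      using a bdd by (auto simp: less_cSUP_iff)
    define \<eta> where "\<eta> m = (\<lambda>j\<in>{- 1..int n}. of_int \<lfloor>real (Suc m) * \<xi> j\<rfloor> / real (Suc m))" for m
    have \<eta>: "(\<lambda>m. \<eta> m j) \<longlonglongrightarrow> \<xi> j" if "- 1 \<le> j" "j \<le> int n" for j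
      using tendsto_round_down[of "\<xi> j"] that by (simp add: \<eta>_def)
    have bt: "(\<lambda>m. b j (\<eta> m i)) \<longlonglongrightarrow> b j (\<xi> i)" if "- 1 \<le> i" "i \<le> int n" for i j
      using continuous_on_tendsto_compose[OF b \<eta>[OF that]] by simp
    have "(\<lambda>m. w (\<eta> m)) \<longlonglongrightarrow> w \<xi>"
      unfolding w_def staircase_weight_def fst_conv snd_conv
      by (intro tendsto_sum tendsto_diff bt) auto
    then have "\<forall>\<^sub>F m in sequentially. a < w (\<eta> m)"
      using \<xi>(2) by (rule order_tendstoD)
    then obtain m where m: "a < w (\<eta> m)"
      by (auto simp: eventually_sequentially)
    have "\<eta> m \<in> rational_staircases n"
      unfolding \<eta>_def by (rule round_down_rational_staircase[OF \<xi>(1)]) simp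
    then obtain i where i: "\<eta> m = ?\<zeta> i"
      using range_from_nat_into[OF rational_staircases_nonempty countable_rational_staircases] by (metis rangeE)
    have "a < Max ((\<lambda>i. w (?\<zeta> i)) ` {..k})" if "k \<ge> i" for k
      using m that unfolding i by (intro less_le_trans[OF _ Max_ge]) auto
    then show "\<forall>\<^sub>F k in sequentially. a < Max ((\<lambda>i. w (?\<zeta> i)) ` {..k})"
      by (auto simp: eventually_sequentially)
  }
qed

section \<open>Covariances of staircase weights\<close>

context ou_brownian_environment
begin

definition evaluation :: "int \<times> real \<times> real \<Rightarrow> 'a \<Rightarrow> real" where
  "evaluation = (\<lambda>(j, r, x). B j r x)"

definition gaussian_hull :: "('a \<Rightarrow> real) set" where
  "gaussian_hull = {X. \<exists>F a. finite F \<and> X = (\<lambda>\<omega>. \<Sum>i\<in>F. a i * evaluation i \<omega>)}"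

lemma gaussian_hullI: "finite F \<Longrightarrow> X = (\<lambda>\<omega>. \<Sum>i\<in>F. a i * evaluation i \<omega>) \<Longrightarrow> X \<in> gaussian_hull"
  unfolding gaussian_hull_def by blast

lemma increment_normal: "x < y \<Longrightarrow> distributed M lborel (\<lambda>\<omega>. B j r y \<omega> - B j r x \<omega>) (normal_density 0 (sqrt (y - x)))"
  using brownian[of j r] unfolding two_sided_brownian_motion_def by blast

lemma B_at_0: "\<omega> \<in> space M \<Longrightarrow> B j r 0 \<omega> = 0"
  using brownian[of j r] unfolding two_sided_brownian_motion_def by blast

lemma B_continuous: "\<omega> \<in> space M \<Longrightarrow> continuous_on UNIV (\<lambda>x. B j r x \<omega>)"
  using brownian[of j r] unfolding two_sided_brownian_motion_def by blast

lemma increment_integrable_centered: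
  assumes "x < y"
  shows "integrable M (\<lambda>\<omega>. B j r y \<omega> - B j r x \<omega>)" "expectation (\<lambda>\<omega>. B j r y \<omega> - B j r x \<omega>) = 0"
proof -
  have s: "sqrt (y - x) > 0" using assms by simp
  show "expectation (\<lambda>\<omega>. B j r y \<omega> - B j r x \<omega>) = 0"
    by (rule normal_distributed_expectation[OF s increment_normal[OF assms]])
  show "integrable M (\<lambda>\<omega>. B j r y \<omega> - B j r x \<omega>)"
    using distributed_integrable[OF increment_normal[OF assms], of "\<lambda>x. x"]
      integrable_normal_moment_nz_1[OF s] by simp
qed

lemma B_integrable_centered: "integrable M (B j r x) \<and> expectation (B j r x) = 0"
proof -
  consider "x = 0" | "0 < x" | "x < 0" by linarith
  then show ?thesis
  proof cases
    case 1
    have "integrable M (B j r 0) \<longleftrightarrow> integrable M (\<lambda>_. 0 :: real)"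
      by (rule Bochner_Integration.integrable_cong) (auto simp: B_at_0)
    moreover have "expectation (B j r 0) = expectation (\<lambda>_. 0)"
      by (rule Bochner_Integration.integral_cong) (auto simp: B_at_0)
    ultimately show ?thesis using 1 by simp
  next
    case 2
    have "integrable M (B j r x) \<longleftrightarrow> integrable M (\<lambda>\<omega>. B j r x \<omega> - B j r 0 \<omega>)"
      by (rule Bochner_Integration.integrable_cong) (auto simp: B_at_0)
    moreover have "expectation (B j r x) = expectation (\<lambda>\<omega>. B j r x \<omega> - B j r 0 \<omega>)"
      by (rule Bochner_Integration.integral_cong) (auto simp: B_at_0)
    ultimately show ?thesis using increment_integrable_centered[OF 2, of j r] by simp
  next
    case 3
    have "integrable M (B j r x) \<longleftrightarrow> integrable M (\<lambda>\<omega>. - (B j r 0 \<omega> - B j r x \<omega>))"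
      by (rule Bochner_Integration.integrable_cong) (auto simp: B_at_0)
    moreover have "expectation (B j r x) = expectation (\<lambda>\<omega>. - (B j r 0 \<omega> - B j r x \<omega>))"
      by (rule Bochner_Integration.integral_cong) (auto simp: B_at_0)
    moreover have "integrable M (\<lambda>\<omega>. - (B j r 0 \<omega> - B j r x \<omega>))"
      using increment_integrable_centered(1)[OF 3, of j r] by (rule Bochner_Integration.integrable_minus)
    ultimately show ?thesis
      using increment_integrable_centered(2)[OF 3, of j r]
      by (simp only: Bochner_Integration.integral_minus minus_zero simp_thms)
  qed
qed

sublocale gaussian_linear_space M gaussian_hull
proof
  show "(\<lambda>_. 0) \<in> gaussian_hull"
    by (rule gaussian_hullI[of "{}"]) simp_all
next
  fix X Y assume "X \<in> gaussian_hull" "Y \<in> gaussian_hull"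
  then obtain F a G b where F: "finite F" "X = (\<lambda>\<omega>. \<Sum>i\<in>F. a i * evaluation i \<omega>)"
    and G: "finite G" "Y = (\<lambda>\<omega>. \<Sum>i\<in>G. b i * evaluation i \<omega>)"
    unfolding gaussian_hull_def by blast
  have "(\<Sum>i\<in>F. a i * evaluation i \<omega>) = (\<Sum>i\<in>F \<union> G. (if i \<in> F then a i else 0) * evaluation i \<omega>)" for \<omega>
    using F G by (intro sum.mono_neutral_cong_left) auto
  moreover have "(\<Sum>i\<in>G. b i * evaluation i \<omega>) = (\<Sum>i\<in>F \<union> G. (if i \<in> G then b i else 0) * evaluation i \<omega>)" for \<omega>
    using F G by (intro sum.mono_neutral_cong_left) auto
  ultimately have "(\<lambda>\<omega>. X \<omega> + Y \<omega>) = (\<lambda>\<omega>. \<Sum>i\<in>F \<union> G. ((if i \<in> F then a i else 0) + (if i \<in> G then b i else 0)) * evaluation i \<omega>)"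
    unfolding F(2) G(2) by (simp only: distrib_right sum.distrib)
  then show "(\<lambda>\<omega>. X \<omega> + Y \<omega>) \<in> gaussian_hull"
    using F(1) G(1) by (intro gaussian_hullI[of "F \<union> G"]) auto
next
  fix X c assume "X \<in> gaussian_hull"
  then obtain F a where F: "finite F" "X = (\<lambda>\<omega>. \<Sum>i\<in>F. a i * evaluation i \<omega>)"
    unfolding gaussian_hull_def by blast
  then have "(\<lambda>\<omega>. c * X \<omega>) = (\<lambda>\<omega>. \<Sum>i\<in>F. (c * a i) * evaluation i \<omega>)"
    by (simp add: sum_distrib_left mult.assoc)
  then show "(\<lambda>\<omega>. c * X \<omega>) \<in> gaussian_hull"
    by (rule gaussian_hullI[OF F(1)])
next
  fix X assume "X \<in> gaussian_hull"
  then obtain F a where F: "finite F" "X = (\<lambda>\<omega>. \<Sum>i\<in>F. a i * evaluation i \<omega>)"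
    unfolding gaussian_hull_def by blast
  then show "gaussian X"
    using gaussian_process unfolding jointly_gaussian_def evaluation_def by simp
  have "integrable M (evaluation i)" "expectation (evaluation i) = 0" for i
    using B_integrable_centered[of "fst i" "fst (snd i)" "snd (snd i)"]
    by (simp_all add: evaluation_def split_beta)
  then show "expectation X = 0"
    unfolding F(2) by simp
qed

lemma B_in_hull: "B j r x \<in> gaussian_hull"
  by (rule gaussian_hullI[of "{(j, r, x)}" _ "\<lambda>_. 1"]) (simp_all add: evaluation_def)

lemma increment_in_hull: "(\<lambda>\<omega>. B j r y \<omega> - B j r x \<omega>) \<in> gaussian_hull"
  using linear_combination[OF B_in_hull B_in_hull, of 1 j r y "-1" j r x] by simp

lemma expectation_increments_same:
  assumes "x < y"
  shows "expectation (\<lambda>\<omega>. (B j r y \<omega> - B j r x \<omega>) * (B j r' y \<omega> - B j r' x \<omega>)) = exp (- \<bar>r - r'\<bar>) * (y - x)"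
proof -
  have var: "variance (\<lambda>\<omega>. B j r y \<omega> - B j r x \<omega>) = y - x" for r
    using normal_distributed_variance[OF _ increment_normal[OF assms], of j r] assms by simp
  have "covariance (\<lambda>\<omega>. B j r y \<omega> - B j r x \<omega>) (\<lambda>\<omega>. B j r' y \<omega> - B j r' x \<omega>) = exp (- \<bar>r - r'\<bar>) * (y - x)"
    using same_increment[OF assms, of j r r'] assms unfolding correlation_def var
    by (simp add: field_simps)
  then show ?thesis
    unfolding covariance_def increment_integrable_centered(2)[OF assms] by simp
qed

lemma expectation_increments_disjoint:
  assumes "x < y" "y \<le> x'" "x' < y'"
  shows "expectation (\<lambda>\<omega>. (B j r y \<omega> - B j r x \<omega>) * (B j r' y' \<omega> - B j r' x' \<omega>)) = 0"
proof -
  have var: "variance (\<lambda>\<omega>. B j r y \<omega> - B j r x \<omega>) = y - x" if "x < y" for r x y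
    using normal_distributed_variance[OF _ increment_normal[OF that], of j r] that by simp
  have "covariance (\<lambda>\<omega>. B j r y \<omega> - B j r x \<omega>) (\<lambda>\<omega>. B j r' y' \<omega> - B j r' x' \<omega>) = 0"
    using disjoint_increments[OF assms, of j r r'] assms
    unfolding correlation_def var[OF assms(1)] var[OF assms(3)] by simp
  then show ?thesis
    unfolding covariance_def increment_integrable_centered(2)[OF assms(1)] increment_integrable_centered(2)[OF assms(3)]
    by simp
qed

text \<open>Split \<open>B j r' y\<close> at \<open>x\<close>: the part beyond \<open>x\<close> is uncorrelated with \<open>B j r x\<close>, also across
different times.\<close>

lemma covariance_same_row_le:
  assumes "0 \<le> x" "x \<le> y"
  shows "expectation (\<lambda>\<omega>. B j r x \<omega> * B j r' y \<omega>) = exp (- \<bar>r - r'\<bar>) * x"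
proof (cases "x = 0")
  case True
  have "expectation (\<lambda>\<omega>. B j r 0 \<omega> * B j r' y \<omega>) = expectation (\<lambda>_. 0)"
    by (rule Bochner_Integration.integral_cong) (auto simp: B_at_0)
  then show ?thesis using True by simp
next
  case False
  then have x: "0 < x" using assms by simp
  have diag: "expectation (\<lambda>\<omega>. B j r x \<omega> * B j r' x \<omega>) = exp (- \<bar>r - r'\<bar>) * x"
  proof -
    have "expectation (\<lambda>\<omega>. B j r x \<omega> * B j r' x \<omega>)
      = expectation (\<lambda>\<omega>. (B j r x \<omega> - B j r 0 \<omega>) * (B j r' x \<omega> - B j r' 0 \<omega>))"
      by (rule Bochner_Integration.integral_cong) (auto simp: B_at_0)
    then show ?thesis using expectation_increments_same[OF x, of j r r'] by simp
  qed
  show ?thesis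
  proof (cases "x = y")
    case False
    have "expectation (\<lambda>\<omega>. B j r x \<omega> * (B j r' y \<omega> - B j r' x \<omega>))
      = expectation (\<lambda>\<omega>. (B j r x \<omega> - B j r 0 \<omega>) * (B j r' y \<omega> - B j r' x \<omega>))"
      by (rule Bochner_Integration.integral_cong) (auto simp: B_at_0)
    also have "\<dots> = 0"
      using False x assms by (intro expectation_increments_disjoint) auto
    finally have "expectation (\<lambda>\<omega>. B j r x \<omega> * B j r' y \<omega>) = expectation (\<lambda>\<omega>. B j r x \<omega> * B j r' x \<omega>)"
      by (simp add: right_diff_distrib mult_integrable B_in_hull)
    then show ?thesis using diag by simp
  qed (use diag in simp)
qed

lemma covariance_distinct_rows:
  assumes "j \<noteq> j'"
  shows "expectation (\<lambda>\<omega>. B j r x \<omega> * B j' r' x' \<omega>) = 0"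
proof -
  define p where "p i = (if i = j then (r, x) else (r', x'))" for i
  have "indep_vars (\<lambda>_. borel) (\<lambda>i \<omega>. (\<lambda>f. f (p i)) ((\<lambda>(r, x). B i r x \<omega>))) UNIV"
    by (rule indep_vars_compose2[OF independent_rows]) auto
  then have "indep_vars (\<lambda>_. borel) (\<lambda>i \<omega>. case p i of (r, x) \<Rightarrow> B i r x \<omega>) {j, j'}"
    using indep_vars_subset[OF _ subset_UNIV] by auto
  moreover have "integrable M (\<lambda>\<omega>. case p i of (r, x) \<Rightarrow> B i r x \<omega>)" for i
    using B_integrable_centered by (cases "p i") auto
  ultimately have "expectation (\<lambda>\<omega>. \<Prod>i\<in>{j, j'}. case p i of (r, x) \<Rightarrow> B i r x \<omega>)
      = (\<Prod>i\<in>{j, j'}. expectation (\<lambda>\<omega>. case p i of (r, x) \<Rightarrow> B i r x \<omega>))"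
    by (intro indep_vars_lebesgue_integral) auto
  then show ?thesis
    using assms B_integrable_centered by (simp add: p_def)
qed

lemma covariance_B:
  assumes "0 \<le> x" "0 \<le> x'"
  shows "expectation (\<lambda>\<omega>. B j r x \<omega> * B j' r' x' \<omega>) = exp (- \<bar>r - r'\<bar>) * (if j = j' then min x x' else 0)"
proof (cases "j = j'")
  case True
  show ?thesis
  proof (cases "x \<le> x'")
    case False
    then show ?thesis
      using True covariance_same_row_le[of x' x j r' r] assms by (simp add: mult.commute min_def abs_minus_commute)
  qed (use True covariance_same_row_le[of x x' j r r'] assms in simp)
qed (simp add: covariance_distinct_rows)

lemma covariance_increments:
  assumes "0 \<le> x" "0 \<le> y" "0 \<le> x'" "0 \<le> y'"
  shows "expectation (\<lambda>\<omega>. (B j r y \<omega> - B j r x \<omega>) * (B j' r' y' \<omega> - B j' r' x' \<omega>))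
    = exp (- \<bar>r - r'\<bar>) * (if j = j' then min y y' - min y x' - min x y' + min x x' else 0)"
proof -
  have "expectation (\<lambda>\<omega>. (B j r y \<omega> - B j r x \<omega>) * (B j' r' y' \<omega> - B j' r' x' \<omega>))
    = expectation (\<lambda>\<omega>. (1 * B j r y \<omega> + (- 1) * B j r x \<omega>) * (1 * B j' r' y' \<omega> + (- 1) * B j' r' x' \<omega>))"
    by (simp only: mult_1 mult_minus1 diff_conv_add_uminus)
  also have "\<dots> = expectation (\<lambda>\<omega>. B j r y \<omega> * B j' r' y' \<omega>) - expectation (\<lambda>\<omega>. B j r y \<omega> * B j' r' x' \<omega>)
    - expectation (\<lambda>\<omega>. B j r x \<omega> * B j' r' y' \<omega>) + expectation (\<lambda>\<omega>. B j r x \<omega> * B j' r' x' \<omega>)"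
    unfolding expectation_mult_linear[OF B_in_hull B_in_hull B_in_hull B_in_hull] by simp
  also have "\<dots> = exp (- \<bar>r - r'\<bar>) * (if j = j' then min y y' - min y x' - min x y' + min x x' else 0)"
    unfolding covariance_B[OF assms(1,3)] covariance_B[OF assms(1,4)] covariance_B[OF assms(2,3)] covariance_B[OF assms(2,4)]
    by (simp add: distrib_left right_diff_distrib)
  finally show ?thesis .
qed

definition weight :: "nat \<Rightarrow> real \<Rightarrow> (int \<Rightarrow> real) \<Rightarrow> 'a \<Rightarrow> real" where
  "weight n r \<xi> \<omega> = staircase_weight (\<lambda>j x. B j r x \<omega>) (0, 0) (real n, int n) \<xi>"

lemma weight_eq: "weight n r \<xi> = (\<lambda>\<omega>. \<Sum>j\<in>{0..int n}. B j r (\<xi> j) \<omega> - B j r (\<xi> (j - 1)) \<omega>)"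
  by (simp add: weight_def staircase_weight_def fun_eq_iff)

lemma weight_in_hull: "weight n r \<xi> \<in> gaussian_hull"
  using finite_linear_combination[of "{0..int n}" "\<lambda>j \<omega>. B j r (\<xi> j) \<omega> - B j r (\<xi> (j - 1)) \<omega>" "\<lambda>_. 1"] increment_in_hull
  by (simp add: weight_eq)

text \<open>The sum is the covariance of the two weights at a common time, so the dynamics multiplies all covariances by the same
factor \<open>exp (- \<bar>r - r'\<bar>)\<close>; this is the hypothesis of \<open>exp_Max_correlated\<close>.\<close>

lemma covariance_weights:
  assumes \<xi>: "\<xi> \<in> staircases (0, 0) (real n, int n)" and \<eta>: "\<eta> \<in> staircases (0, 0) (real n, int n)"
  shows "expectation (\<lambda>\<omega>. weight n r \<xi> \<omega> * weight n r' \<eta> \<omega>)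
    = exp (- \<bar>r - r'\<bar>) * (\<Sum>j\<in>{0..int n}. min (\<xi> j) (\<eta> j) - min (\<xi> j) (\<eta> (j - 1)) - min (\<xi> (j - 1)) (\<eta> j) + min (\<xi> (j - 1)) (\<eta> (j - 1)))"
proof -
  let ?c = "\<lambda>j. min (\<xi> j) (\<eta> j) - min (\<xi> j) (\<eta> (j - 1)) - min (\<xi> (j - 1)) (\<eta> j) + min (\<xi> (j - 1)) (\<eta> (j - 1))"
  have "expectation (\<lambda>\<omega>. weight n r \<xi> \<omega> * weight n r' \<eta> \<omega>)
    = (\<Sum>j\<in>{0..int n}. \<Sum>j'\<in>{0..int n}. expectation (\<lambda>\<omega>. (B j r (\<xi> j) \<omega> - B j r (\<xi> (j - 1)) \<omega>) *
         (B j' r' (\<eta> j') \<omega> - B j' r' (\<eta> (j' - 1)) \<omega>)))"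
    by (simp only: weight_eq sum_product Bochner_Integration.integral_sum mult_integrable[OF increment_in_hull increment_in_hull]
        Bochner_Integration.integrable_sum)
  also have "\<dots> = (\<Sum>j\<in>{0..int n}. \<Sum>j'\<in>{0..int n}. if j = j' then exp (- \<bar>r - r'\<bar>) * ?c j else 0)"
    using staircase_range(1)[OF \<xi>] staircase_range(1)[OF \<eta>]
    by (intro sum.cong refl) (auto simp: covariance_increments)
  also have "\<dots> = exp (- \<bar>r - r'\<bar>) * (\<Sum>j\<in>{0..int n}. ?c j)"
    by (simp add: sum_distrib_left sum.delta)
  finally show ?thesis .
qed

text \<open>The increments along a staircase lie in distinct rows, so they are uncorrelated; the variance of each is its length, and the
lengths telescope to \<open>n\<close>.\<close>

lemma variance_weight:
  assumes \<xi>: "\<xi> \<in> staircases (0, 0) (real n, int n)"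
  shows "expectation (\<lambda>\<omega>. (weight n r \<xi> \<omega>)\<^sup>2) = real n"
proof -
  have tel: "(\<Sum>j\<in>{0..int m}. \<xi> j - \<xi> (j - 1)) = \<xi> (int m) - \<xi> (- 1)" for m
  proof (induction m)
    case (Suc m)
    have "{0..int (Suc m)} = insert (int (Suc m)) {0..int m}" by auto
    then show ?case using Suc by simp
  qed simp
  have "expectation (\<lambda>\<omega>. (weight n r \<xi> \<omega>)\<^sup>2) = (\<Sum>j\<in>{0..int n}. \<xi> j - \<xi> (j - 1))"
    unfolding power2_eq_square covariance_weights[OF \<xi> \<xi>]
    using staircase_endpoints(3)[OF \<xi>] by (auto intro!: sum.cong simp: min_absorb1 min_absorb2)
  then show ?thesis using tel[of n] staircase_endpoints[OF \<xi>] by simp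
qed

section \<open>Exponential moments of passage time increments\<close>

abbreviation diagonal_time :: "nat \<Rightarrow> real \<Rightarrow> 'a \<Rightarrow> real" where
  "diagonal_time n \<equiv> passage_time B (0, 0) (real n, int n)"

lemma Max_weight_tendsto:
  assumes "\<omega> \<in> space M"
  shows "(\<lambda>m. Max ((\<lambda>i. weight n r (from_nat_into (rational_staircases n) i) \<omega>) ` {..m})) \<longlonglongrightarrow> diagonal_time n r \<omega>"
  unfolding passage_time_def weight_def
  using B_continuous[OF assms] by (intro Max_rational_staircases_tendsto)

lemma diagonal_time_measurable: "diagonal_time n r \<in> borel_measurable M"
  by (rule borel_measurable_LIMSEQ_real, rule Max_weight_tendsto, assumption)
     (intro Max_measurable, auto simp: weight_in_hull)

text \<open>Gaussian comparison for the maxima over the first \<open>m\<close> rational staircases, with a bound that does not depend on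
\<open>m\<close>, followed by Fatou's lemma.\<close>

lemma nn_integral_exp_increment:
  assumes t: "0 < \<bar>r - r'\<bar>" and \<gamma>: "\<gamma> \<ge> 0"
  shows "(\<integral>\<^sup>+\<omega>. ennreal (exp (\<gamma> * (diagonal_time n r \<omega> - diagonal_time n r' \<omega>))) \<partial>M)
    \<le> ennreal (exp (4 * \<gamma>\<^sup>2 * (real n * (1 - exp (- \<bar>r - r'\<bar>)))))"
proof -
  define \<phi> where "\<phi> = arccos (exp (- \<bar>r - r'\<bar>))"
  have \<rho>: "0 < exp (- \<bar>r - r'\<bar>)" "exp (- \<bar>r - r'\<bar>) < 1" using t by auto
  have cos: "cos \<phi> = exp (- \<bar>r - r'\<bar>)"
    unfolding \<phi>_def using \<rho> by (intro cos_arccos) linarith+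
  have "- 1 < exp (- \<bar>r - r'\<bar>)" using \<rho> by linarith
  then have "0 < \<phi>" "\<phi> \<le> pi / 2"
    unfolding \<phi>_def using \<rho> by (simp_all only: arccos_lt_bounded arccos_le_pi2 less_imp_le)
  then have \<phi>: "0 < \<phi>" "\<phi> < pi" "\<phi> \<le> pi / 2" using pi_gt_zero by linarith+
  define \<zeta> where "\<zeta> = from_nat_into (rational_staircases n)"
  have \<zeta>: "\<zeta> i \<in> staircases (0, 0) (real n, int n)" for i
    using from_nat_into[OF rational_staircases_nonempty[of n], of i] by (simp add: \<zeta>_def rational_staircases_def)
  define A where "A m r \<omega> = Max ((\<lambda>i. weight n r (\<zeta> i) \<omega>) ` {..m})" for m r \<omega>
  have Am[measurable]: "A m r \<in> borel_measurable M" for m r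
    unfolding A_def by (intro Max_measurable) (auto simp: weight_in_hull)
  have At: "(\<lambda>m. A m r \<omega>) \<longlonglongrightarrow> diagonal_time n r \<omega>" if "\<omega> \<in> space M" for r \<omega>
    unfolding A_def \<zeta>_def by (rule Max_weight_tendsto[OF that])
  let ?E = "ennreal (exp (4 * \<gamma>\<^sup>2 * (real n * (1 - exp (- \<bar>r - r'\<bar>)))))"
  have bound: "(\<integral>\<^sup>+\<omega>. ennreal (exp (\<gamma> * (A m r \<omega> - A m r' \<omega>))) \<partial>M) \<le> ?E" for m
  proof -
    have "(\<integral>\<^sup>+\<omega>. ennreal (exp (\<gamma> * (A m r \<omega> - A m r' \<omega>))) \<partial>M) \<le> ennreal (exp ((\<gamma> * \<phi>)\<^sup>2 * real n / 2))"
      unfolding A_def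
    proof (rule exp_Max_correlated[OF _ _ _ _ _ _ _ \<gamma> \<phi>(1,2)])
      fix i i'
      show "expectation (\<lambda>\<omega>. weight n r (\<zeta> i) \<omega> * weight n r (\<zeta> i') \<omega>) = expectation (\<lambda>\<omega>. weight n r' (\<zeta> i) \<omega> * weight n r' (\<zeta> i') \<omega>)"
        unfolding covariance_weights[OF \<zeta> \<zeta>] by simp
      show "expectation (\<lambda>\<omega>. weight n r (\<zeta> i) \<omega> * weight n r' (\<zeta> i') \<omega>) = cos \<phi> * expectation (\<lambda>\<omega>. weight n r' (\<zeta> i) \<omega> * weight n r' (\<zeta> i') \<omega>)"
        unfolding covariance_weights[OF \<zeta> \<zeta>] cos by simp
      show "expectation (\<lambda>\<omega>. (weight n r' (\<zeta> i) \<omega>)\<^sup>2) \<le> real n"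
        unfolding variance_weight[OF \<zeta>] ..
    qed (auto simp: weight_in_hull)
    also have "(\<gamma> * \<phi>)\<^sup>2 * real n / 2 \<le> 4 * \<gamma>\<^sup>2 * (real n * (1 - exp (- \<bar>r - r'\<bar>)))"
      using mult_left_mono[OF square_le_one_minus_cos[of \<phi>], of "\<gamma>\<^sup>2 * real n / 2"] \<phi>
      by (simp add: cos power_mult_distrib right_diff_distrib mult_ac)
    then have "ennreal (exp ((\<gamma> * \<phi>)\<^sup>2 * real n / 2)) \<le> ?E" by (intro ennreal_leI) simp
    finally show ?thesis .
  qed
  have "(\<integral>\<^sup>+\<omega>. ennreal (exp (\<gamma> * (diagonal_time n r \<omega> - diagonal_time n r' \<omega>))) \<partial>M)
    = (\<integral>\<^sup>+\<omega>. liminf (\<lambda>m. ennreal (exp (\<gamma> * (A m r \<omega> - A m r' \<omega>)))) \<partial>M)"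
  proof (rule nn_integral_cong)
    fix \<omega> assume "\<omega> \<in> space M"
    then have "(\<lambda>m. ennreal (exp (\<gamma> * (A m r \<omega> - A m r' \<omega>)))) \<longlonglongrightarrow> ennreal (exp (\<gamma> * (diagonal_time n r \<omega> - diagonal_time n r' \<omega>)))"
      by (intro tendsto_ennrealI tendsto_intros At)
    then show "ennreal (exp (\<gamma> * (diagonal_time n r \<omega> - diagonal_time n r' \<omega>))) = liminf (\<lambda>m. ennreal (exp (\<gamma> * (A m r \<omega> - A m r' \<omega>))))"
      by (intro lim_imp_Liminf[symmetric]) simp_all
  qed
  also have "\<dots> \<le> liminf (\<lambda>m. \<integral>\<^sup>+\<omega>. ennreal (exp (\<gamma> * (A m r \<omega> - A m r' \<omega>))) \<partial>M)"
    by (rule nn_integral_liminf) measurable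
  also have "\<dots> \<le> ?E"
    using bound by (intro Liminf_le) (auto)
  finally show ?thesis .
qed

lemma nn_integral_exp_abs_increment:
  assumes t: "t > 0" and \<gamma>: "\<gamma> \<ge> 0"
  shows "(\<integral>\<^sup>+\<omega>. ennreal (exp (\<gamma> * \<bar>diagonal_time n t \<omega> - diagonal_time n 0 \<omega>\<bar>)) \<partial>M)
    \<le> ennreal (2 * exp (4 * \<gamma>\<^sup>2 * (real n * (1 - exp (- t)))))"
proof -
  note [measurable] = diagonal_time_measurable
  have "(\<integral>\<^sup>+\<omega>. ennreal (exp (\<gamma> * \<bar>diagonal_time n t \<omega> - diagonal_time n 0 \<omega>\<bar>)) \<partial>M)
    \<le> (\<integral>\<^sup>+\<omega>. ennreal (exp (\<gamma> * (diagonal_time n t \<omega> - diagonal_time n 0 \<omega>))) + ennreal (exp (\<gamma> * (diagonal_time n 0 \<omega> - diagonal_time n t \<omega>))) \<partial>M)"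
    by (intro nn_integral_mono) (auto simp: abs_if simp flip: ennreal_plus intro!: ennreal_leI)
  also have "\<dots> = (\<integral>\<^sup>+\<omega>. ennreal (exp (\<gamma> * (diagonal_time n t \<omega> - diagonal_time n 0 \<omega>))) \<partial>M)
      + (\<integral>\<^sup>+\<omega>. ennreal (exp (\<gamma> * (diagonal_time n 0 \<omega> - diagonal_time n t \<omega>))) \<partial>M)"
    by (rule nn_integral_add) measurable
  also have "\<dots> \<le> ennreal (exp (4 * \<gamma>\<^sup>2 * (real n * (1 - exp (- t))))) + ennreal (exp (4 * \<gamma>\<^sup>2 * (real n * (1 - exp (- t)))))"
    using nn_integral_exp_increment[of t 0 \<gamma> n] nn_integral_exp_increment[of 0 t \<gamma> n] t \<gamma>
    by (intro add_mono) auto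
  also have "\<dots> = ennreal (2 * exp (4 * \<gamma>\<^sup>2 * (real n * (1 - exp (- t)))))"
    by (simp flip: ennreal_plus)
  finally show ?thesis .
qed

end

theorem theorem5:
  shows "\<exists>C :: real. \<forall>(M :: 'a measure) B. ou_brownian_environment M B \<longrightarrow>
    (\<forall>(n :: nat) (t :: real). n \<ge> 1 \<longrightarrow> t \<ge> 0 \<longrightarrow>
      (\<forall>k :: real. k \<ge> 2 \<longrightarrow>
         integrable M (\<lambda>\<omega>. \<bar>passage_time B (0, 0) (real n, int n) t \<omega>
             - passage_time B (0, 0) (real n, int n) 0 \<omega>\<bar> powr k) \<and>
         Lp_norm M k (\<lambda>\<omega>. passage_time B (0, 0) (real n, int n) t \<omega>
             - passage_time B (0, 0) (real n, int n) 0 \<omega>)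
           \<le> C * sqrt (k * real n * (1 - exp (- t))) \<and>
         C * sqrt (k * real n * (1 - exp (- t))) \<le> C * sqrt (k * real n * t)) \<and>
      (\<forall>u :: real. u \<ge> 2 \<longrightarrow>
         measure M {\<omega> \<in> space M.
             \<bar>passage_time B (0, 0) (real n, int n) t \<omega>
               - passage_time B (0, 0) (real n, int n) 0 \<omega>\<bar>
             > C * sqrt (real n * (1 - exp (- t)) * u)}
           \<le> 2 * exp (- u)))"
proof (rule exI[of _ 7], intro allI impI)
  fix M :: "'a measure" and B and n :: nat and t :: real
  assume "ou_brownian_environment M B" and n: "n \<ge> 1" and t: "t \<ge> 0"
  then interpret ou_brownian_environment M B by simp
  let ?D = "\<lambda>\<omega>. diagonal_time n t \<omega> - diagonal_time n 0 \<omega>" and ?v = "real n * (1 - exp (- t))"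
  have Dm: "?D \<in> borel_measurable M" using diagonal_time_measurable by simp
  have le: "7 * sqrt (k * real n * (1 - exp (- t))) \<le> 7 * sqrt (k * real n * t)" if "k \<ge> 2" for k
    using exp_ge_add_one_self[of "- t"] that by (intro mult_left_mono real_sqrt_le_mono) auto
  show "(\<forall>k \<ge> 2. integrable M (\<lambda>\<omega>. \<bar>?D \<omega>\<bar> powr k) \<and>
         Lp_norm M k ?D \<le> 7 * sqrt (k * real n * (1 - exp (- t))) \<and>
         7 * sqrt (k * real n * (1 - exp (- t))) \<le> 7 * sqrt (k * real n * t)) \<and>
      (\<forall>u \<ge> 2. measure M {\<omega> \<in> space M. \<bar>?D \<omega>\<bar> > 7 * sqrt (?v * u)} \<le> 2 * exp (- u))"
  proof (cases "t = 0")
    case True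
    then show ?thesis by (simp add: Lp_norm_def)
  next
    case False
    then have "t > 0" using t by simp
    then have v: "?v > 0" using n by simp
    note mgf = nn_integral_exp_abs_increment[OF \<open>t > 0\<close>, of _ n]
    show ?thesis
      using subgaussian_moments[OF Dm v _ mgf] subgaussian_tail[OF Dm v _ mgf, of _ 7] le
      by (auto simp: mult.assoc)
  qed
qed

end
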